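(* Let $k$ be an arbitrary field. The arithmetic genus is not a birational invariant of projective varieties over $k$ in general: there exist projective varieties $Y$ and $Y'$ over $k$, of the same dimension, such that $Y$ and $Y'$ are birational but $p_a(Y)\neq p_a(Y')$.
   Context: A projective variety $Y\subseteq \mathbb{P}^N_k$ over a field $k$ is defined by a homogeneous prime ideal $I(Y)\subseteq k[x_0,\ldots,x_N]$, i.e. $Y\cong \operatorname{Proj}(S)$ with $S=k[x_0,\ldots,x_N]/I(Y)$; it may be singular. The Hilbert polynomial $P_Y(t)$ is the polynomial with $P_Y(t)=\dim_k S_t$ for all $t\gg 0$. If $r=\dim Y$, the arithmetic genus is $p_a(Y):=(-1)^r(P_Y(0)-1)$; it is independent of the choice of projective embedding. Two varieties $Y,Y'$ of the same dimension are birational if there are nonempty open subvarieties $U\subseteq Y$ and $U'\subseteq Y'$ and an isomorphism of varieties $U\cong U'$ over $k$. *)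

theory Defs
  imports
    "HOL-Algebra.Embedded_Algebras"
    "HOL-Algebra.QuotRing"
    "HOL-Analysis.Function_Topology"
    "HOL-Computational_Algebra.Polynomial"
    "HOL-Library.Extended_Nat"
    "HOL-Library.FuncSet"
    "HOL-Library.Poly_Mapping"
begin

section \<open>Graded algebras\<close>

text \<open>
  The data of a commutative ring \<open>S\<close> graded by the natural numbers, together with the structure
  map \<open>k \<rightarrow> S\<close> of a \<open>k\<close>-algebra; the records do not impose the axioms.
\<close>

record ('a, 'k) graded_algebra = "'a ring" +
  grade :: "nat \<Rightarrow> 'a set"
  scalar :: "'k \<Rightarrow> 'a"

definition homogeneous_ideal :: "'a set \<Rightarrow> ('a, 'k) graded_algebra \<Rightarrow> bool" where
  "homogeneous_ideal P S \<longleftrightarrow> ideal P S \<and> P = Idl\<^bsub>S\<^esub> (P \<inter> (\<Union>d. grade S d))"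

definition irrelevant_ideal :: "('a, 'k) graded_algebra \<Rightarrow> 'a set" where
  "irrelevant_ideal S = Idl\<^bsub>S\<^esub> (\<Union>d\<in>{0<..}. grade S d)"

text \<open>The Hilbert function counts dimensions over the image of \<open>k\<close> in \<open>S\<close>.\<close>

definition hilbert_function :: "('a, 'k) graded_algebra \<Rightarrow> nat \<Rightarrow> nat" where
  "hilbert_function S t = ring.dim S (range (scalar S)) (grade S t)"

definition hilbert_polynomial :: "('a, 'k) graded_algebra \<Rightarrow> rat poly" where
  "hilbert_polynomial S =
     (THE P. \<forall>\<^sub>F t in sequentially. poly P (of_nat t) = of_nat (hilbert_function S t))"


section \<open>Ringed spaces over a field\<close>

text \<open>
  A topological space \<open>space_top X\<close> with, for every open \<open>U\<close>, a ring \<open>sections X U\<close>, restriction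
  maps \<open>restr X U V\<close> for open \<open>V \<subseteq> U\<close>, and structure maps \<open>const X U\<close> from \<open>k\<close> to \<open>sections X U\<close>.
\<close>

record ('p, 's, 'k) ringed_space =
  space_top :: "'p topology"
  sections :: "'p set \<Rightarrow> 's ring"
  restr :: "'p set \<Rightarrow> 'p set \<Rightarrow> 's \<Rightarrow> 's"
  const :: "'p set \<Rightarrow> 'k \<Rightarrow> 's"

definition open_subspace ::
    "('p, 's, 'k) ringed_space \<Rightarrow> 'p set \<Rightarrow> ('p, 's, 'k) ringed_space" where
  "open_subspace X U = X\<lparr>space_top := subtopology (space_top X) U\<rparr>"

definition preim :: "('p, 's, 'k) ringed_space \<Rightarrow> ('p \<Rightarrow> 'q) \<Rightarrow> 'q set \<Rightarrow> 'p set" where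
  "preim X f V = {x \<in> topspace (space_top X). f x \<in> V}"

text \<open>
  An isomorphism is a homeomorphism \<open>f\<close> with an isomorphism \<open>\<phi>\<close> from the structure sheaf of
  \<open>X'\<close> to the direct image of that of \<open>X\<close>, linear over \<open>k\<close>. The induced maps on stalks are then
  ring isomorphisms, hence automatically local, so between locally ringed spaces this is the same
  thing as an isomorphism of locally ringed spaces over \<open>k\<close>.
\<close>

definition isomorphic_over ::
    "('p, 's, 'k) ringed_space \<Rightarrow> ('q, 't, 'k) ringed_space \<Rightarrow> bool" where
  "isomorphic_over X X' \<longleftrightarrow>
     (\<exists>f \<phi>. homeomorphic_map (space_top X) (space_top X') f
       \<and> (\<forall>V. openin (space_top X') V \<longrightarrow>
            \<phi> V \<in> ring_iso (sections X' V) (sections X (preim X f V))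
            \<and> (\<forall>c. \<phi> V (const X' V c) = const X (preim X f V) c))
       \<and> (\<forall>V W. openin (space_top X') V \<longrightarrow> openin (space_top X') W \<longrightarrow> W \<subseteq> V \<longrightarrow>
            (\<forall>s \<in> carrier (sections X' V).
               \<phi> W (restr X' V W s) = restr X (preim X f V) (preim X f W) (\<phi> V s))))"

definition irreducible_closed :: "'p topology \<Rightarrow> 'p set \<Rightarrow> bool" where
  "irreducible_closed T Z \<longleftrightarrow> closedin T Z \<and> Z \<noteq> {}
     \<and> (\<forall>A B. closedin T A \<longrightarrow> closedin T B \<longrightarrow> Z = A \<union> B \<longrightarrow> Z = A \<or> Z = B)"

definition krull_dim :: "'p topology \<Rightarrow> enat" where
  "krull_dim T = Sup {enat n | n.
     \<exists>Z. (\<forall>i\<le>n. irreducible_closed T (Z i)) \<and> (\<forall>i<n. Z i \<subset> Z (Suc i))}"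


section \<open>The ringed space Proj\<close>

definition proj_points :: "('a, 'k) graded_algebra \<Rightarrow> 'a set set" where
  "proj_points S = {P. primeideal P S \<and> homogeneous_ideal P S \<and> \<not> irrelevant_ideal S \<subseteq> P}"

definition basic_open :: "('a, 'k) graded_algebra \<Rightarrow> 'a \<Rightarrow> 'a set set" where
  "basic_open S f = {P \<in> proj_points S. f \<notin> P}"

definition zariski :: "('a, 'k) graded_algebra \<Rightarrow> 'a set topology" where
  "zariski S = topology_generated_by {basic_open S f | f. f \<in> (\<Union>d. grade S d)}"

text \<open>
  The homogeneous localization \<open>S\<^sub>(\<^sub>P\<^sub>)\<close>: fractions \<open>a/f\<close> with \<open>a\<close>, \<open>f\<close> homogeneous of the same
  degree and \<open>f \<notin> P\<close>.
\<close>

definition fractions :: "('a, 'k) graded_algebra \<Rightarrow> 'a set \<Rightarrow> ('a \<times> 'a) set" where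
  "fractions S P = {(a, f). \<exists>d. a \<in> grade S d \<and> f \<in> grade S d \<and> f \<notin> P}"

definition fraction_rel :: "('a, 'k) graded_algebra \<Rightarrow> 'a set \<Rightarrow> (('a \<times> 'a) \<times> ('a \<times> 'a)) set" where
  "fraction_rel S P = {((a, f), (b, g)). (a, f) \<in> fractions S P \<and> (b, g) \<in> fractions S P
     \<and> (\<exists>h \<in> (\<Union>d. grade S d) - P. h \<otimes>\<^bsub>S\<^esub> (a \<otimes>\<^bsub>S\<^esub> g) = h \<otimes>\<^bsub>S\<^esub> (b \<otimes>\<^bsub>S\<^esub> f))}"

definition fraction :: "('a, 'k) graded_algebra \<Rightarrow> 'a set \<Rightarrow> 'a \<Rightarrow> 'a \<Rightarrow> ('a \<times> 'a) set" where
  "fraction S P a f = fraction_rel S P `` {(a, f)}"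

definition hom_localization :: "('a, 'k) graded_algebra \<Rightarrow> 'a set \<Rightarrow> ('a \<times> 'a) set ring" where
  "hom_localization S P = \<lparr>
     carrier = fractions S P // fraction_rel S P,
     monoid.mult = (\<lambda>X Y. \<Union>(a, f)\<in>X. \<Union>(b, g)\<in>Y. fraction S P (a \<otimes>\<^bsub>S\<^esub> b) (f \<otimes>\<^bsub>S\<^esub> g)),
     one = fraction S P \<one>\<^bsub>S\<^esub> \<one>\<^bsub>S\<^esub>,
     zero = fraction S P \<zero>\<^bsub>S\<^esub> \<one>\<^bsub>S\<^esub>,
     add = (\<lambda>X Y. \<Union>(a, f)\<in>X. \<Union>(b, g)\<in>Y.
              fraction S P ((a \<otimes>\<^bsub>S\<^esub> g) \<oplus>\<^bsub>S\<^esub> (b \<otimes>\<^bsub>S\<^esub> f)) (f \<otimes>\<^bsub>S\<^esub> g))\<rparr>"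

text \<open>
  Sections over \<open>U\<close> are families of elements of the stalks \<open>S\<^sub>(\<^sub>P\<^sub>)\<close>, \<open>P \<in> U\<close>, that are locally given
  by a single fraction. They are \<open>undefined\<close> outside \<open>U\<close>, so that equality of sections is
  equality on \<open>U\<close>.
\<close>

definition proj_sections ::
    "('a, 'k) graded_algebra \<Rightarrow> 'a set set \<Rightarrow> ('a set \<Rightarrow> ('a \<times> 'a) set) ring" where
  "proj_sections S U = \<lparr>
     carrier = {s \<in> (\<Pi>\<^sub>E P\<in>U. carrier (hom_localization S P)).
       \<forall>P\<in>U. \<exists>V. openin (zariski S) V \<and> P \<in> V \<and> V \<subseteq> U \<and>
         (\<exists>d. \<exists>a\<in>grade S d. \<exists>f\<in>grade S d. \<forall>Q\<in>V. f \<notin> Q \<and> s Q = fraction S Q a f)},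
     monoid.mult = (\<lambda>s t. \<lambda>P\<in>U. s P \<otimes>\<^bsub>hom_localization S P\<^esub> t P),
     one = (\<lambda>P\<in>U. \<one>\<^bsub>hom_localization S P\<^esub>),
     zero = (\<lambda>P\<in>U. \<zero>\<^bsub>hom_localization S P\<^esub>),
     add = (\<lambda>s t. \<lambda>P\<in>U. s P \<oplus>\<^bsub>hom_localization S P\<^esub> t P)\<rparr>"

definition Proj ::
    "('a, 'k) graded_algebra \<Rightarrow> ('a set, 'a set \<Rightarrow> ('a \<times> 'a) set, 'k) ringed_space" where
  "Proj S = \<lparr>
     space_top = zariski S,
     sections = proj_sections S,
     restr = (\<lambda>U V s. restrict s V),
     const = (\<lambda>U c. \<lambda>P\<in>U. fraction S P (scalar S c) \<one>\<^bsub>S\<^esub>)\<rparr>"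


section \<open>Projective varieties\<close>

text \<open>
  Polynomials are finitely supported maps from exponent vectors to coefficients; the ring
  \<open>k[x\<^sub>0, \<dots>, x\<^sub>N]\<close> consists of those in which only the variables with index at most \<open>N\<close> occur.
\<close>

type_synonym 'k mpoly = "(nat \<Rightarrow>\<^sub>0 nat) \<Rightarrow>\<^sub>0 'k"

definition monom_degree :: "(nat \<Rightarrow>\<^sub>0 nat) \<Rightarrow> nat" where
  "monom_degree m = (\<Sum>i\<in>Poly_Mapping.keys m. Poly_Mapping.lookup m i)"

definition polynomials :: "nat \<Rightarrow> 'k::zero mpoly set" where
  "polynomials N = {p. \<forall>m\<in>Poly_Mapping.keys p. Poly_Mapping.keys m \<subseteq> {..N}}"

definition poly_algebra :: "nat \<Rightarrow> ('k::field mpoly, 'k) graded_algebra" where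
  "poly_algebra N = \<lparr>
     carrier = polynomials N, monoid.mult = (*), one = 1, zero = 0, add = (+),
     grade = (\<lambda>d. {p \<in> polynomials N. \<forall>m\<in>Poly_Mapping.keys p. monom_degree m = d}),
     scalar = (\<lambda>c. Poly_Mapping.single 0 c)\<rparr>"

text \<open>
  A projective variety in \<open>\<bbbP>\<^sup>N\<close> is given by its ideal. The irrelevant ideal, which is prime and
  homogeneous but defines the empty scheme, is excluded.
\<close>

definition projective_variety :: "nat \<Rightarrow> 'k::field mpoly set \<Rightarrow> bool" where
  "projective_variety N I \<longleftrightarrow> primeideal I (poly_algebra N) \<and> homogeneous_ideal I (poly_algebra N)
     \<and> I \<noteq> irrelevant_ideal (poly_algebra N)"

definition coordinate_algebra ::
    "nat \<Rightarrow> 'k::field mpoly set \<Rightarrow> ('k mpoly set, 'k) graded_algebra" where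
  "coordinate_algebra N I = ring.extend (poly_algebra N Quot I)
     (graded_algebra.fields
       (\<lambda>d. (\<lambda>p. I +>\<^bsub>poly_algebra N\<^esub> p) ` grade (poly_algebra N) d)
       (\<lambda>c. I +>\<^bsub>poly_algebra N\<^esub> scalar (poly_algebra N) c))"

definition variety_space ::
    "nat \<Rightarrow> 'k::field mpoly set \<Rightarrow>
       ('k mpoly set set, 'k mpoly set set \<Rightarrow> ('k mpoly set \<times> 'k mpoly set) set, 'k) ringed_space"
  where "variety_space N I = Proj (coordinate_algebra N I)"

definition variety_dim :: "nat \<Rightarrow> 'k::field mpoly set \<Rightarrow> enat" where
  "variety_dim N I = krull_dim (space_top (variety_space N I))"

definition arithmetic_genus :: "nat \<Rightarrow> 'k::field mpoly set \<Rightarrow> rat" where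
  "arithmetic_genus N I = (- 1) ^ the_enat (variety_dim N I)
     * (poly (hilbert_polynomial (coordinate_algebra N I)) 0 - 1)"

definition birational ::
    "('p, 's, 'k) ringed_space \<Rightarrow> ('q, 't, 'k) ringed_space \<Rightarrow> bool" where
  "birational X X' \<longleftrightarrow> (\<exists>U U'. openin (space_top X) U \<and> U \<noteq> {} \<and> openin (space_top X') U' \<and> U' \<noteq> {}
     \<and> isomorphic_over (open_subspace X U) (open_subspace X' U'))"

end

theory Submission
  imports Defs
begin

text \<open>
  The two varieties are the twisted cubic \<open>Y\<close> in \<open>\<bbbP>\<^sup>3\<close> and the cuspidal plane cubic \<open>Y'\<close> with
  equation \<open>x\<^sub>1\<^sup>3 = x\<^sub>0 x\<^sub>2\<^sup>2\<close>. Both are images of the projective line: with an affine parameter \<open>u\<close> and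
  an indeterminate \<open>T\<close> that records the degree, the coordinates \<open>x\<^sub>0, x\<^sub>1, x\<^sub>2, x\<^sub>3\<close> become
  \<open>T, u\<^sup>2T, u\<^sup>3T, uT\<close>, and \<open>Y'\<close> is the projection of \<open>Y\<close> that forgets \<open>x\<^sub>3\<close>. Hence the homogeneous
  coordinate ring of \<open>Y\<close> is the ring \<open>B\<close> of all \<open>F\<close> in \<open>k[u][T]\<close> whose coefficient at \<open>T\<^sup>d\<close> is a
  polynomial in \<open>u\<close> of degree at most \<open>3d\<close>, and that of \<open>Y'\<close> is the subring \<open>A\<close> in which, moreover,
  these coefficients have no term in \<open>u\<^sup>1\<close> (lemma \<open>curve_algebra_embedding\<close>). Counting monomials,
  \<open>dim B\<^sub>t = 3t + 1\<close> and \<open>dim A\<^sub>t = 3t\<close> for \<open>t \<ge> 1\<close>. The Hilbert polynomials therefore take the values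
  \<open>1\<close> and \<open>0\<close> at \<open>0\<close>, so that one arithmetic genus vanishes and the other does not, whatever the
  field.

  Both curves are compared through the contraction \<open>P \<mapsto> P \<inter> A\<close> of homogeneous primes of \<open>B\<close>. Since
  \<open>u\<^sup>3T \<cdot> B \<subseteq> A\<close>, every homogeneous fraction over \<open>B\<close> can be expanded by \<open>u\<^sup>3T\<close> to a fraction over \<open>A\<close>;
  thus contraction is an isomorphism between the open subsets \<open>u\<^sup>3T \<noteq> 0\<close>
  (\<open>isomorphic_over_basic_open\<close>), and the curves are birational.

  It remains to see that the dimensions agree. They need not be computed: contraction is a
  homeomorphism between the whole curves (\<open>homeomorphic_contraction\<close>), and the Krull dimension is a
  topological invariant. Where \<open>u\<^sup>3T\<close> vanishes, each of the curves has a single point, the image of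
  \<open>u = 0\<close> (\<open>point_eq_cusp\<close>), so contraction is surjective. For openness and injectivity the
  following suffices: every homogeneous \<open>h\<close> outside of \<open>P\<close> has a homogeneous multiple outside of \<open>P\<close>
  that lies in \<open>A\<close>. At the point \<open>u = 0\<close> one can take the multiple by \<open>(1 + \<alpha>u)T\<close>, where \<open>\<alpha>\<close> is
  chosen such that the linear term cancels.
\<close>

section \<open>Graded domains and their homogeneous primes\<close>

text \<open>
  The operations on the homogeneous localization are unions over all representatives; they are
  evaluated by showing that every pair of representatives contributes the same class.
\<close>

lemma UN_pairs_constant:
  assumes "(a, f) \<in> X" "(b, g) \<in> Y"
    and "\<And>a f b g. (a, f) \<in> X \<Longrightarrow> (b, g) \<in> Y \<Longrightarrow> F a f b g = Z"
  shows "(\<Union>(a, f)\<in>X. \<Union>(b, g)\<in>Y. F a f b g) = Z"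
proof -
  have "(\<Union>(b, g)\<in>Y. F a f b g) = Z" if "(a, f) \<in> X" for a f
    using assms(2) assms(3)[OF that] by force
  then show ?thesis using assms(1) by force
qed

text \<open>
  The axioms of a graded domain, with the projections to the homogeneous components as part of the
  structure: an ideal is homogeneous if and only if it is stable under these projections, which is
  far easier to work with than generation by homogeneous elements.
\<close>

locale graded_domain = domain S for S :: "('a, 'k) graded_algebra" (structure) +
  fixes component :: "nat \<Rightarrow> 'a \<Rightarrow> 'a"
  assumes grade_carrier: "x \<in> grade S d \<Longrightarrow> x \<in> carrier S"
    and one_grade: "\<one> \<in> grade S 0"
    and grade_mult: "a \<in> grade S d \<Longrightarrow> b \<in> grade S e \<Longrightarrow> a \<otimes> b \<in> grade S (d + e)"
    and grade_add: "a \<in> grade S d \<Longrightarrow> b \<in> grade S d \<Longrightarrow> a \<oplus> b \<in> grade S d"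
    and component_grade: "x \<in> carrier S \<Longrightarrow> component d x \<in> grade S d"
    and component_homogeneous: "x \<in> grade S e \<Longrightarrow> component d x = (if d = e then x else \<zero>)"
    and component_add: "x \<in> carrier S \<Longrightarrow> y \<in> carrier S \<Longrightarrow>
      component d (x \<oplus> y) = component d x \<oplus> component d y"
    and component_mult: "a \<in> grade S e \<Longrightarrow> x \<in> carrier S \<Longrightarrow>
      component d (a \<otimes> x) = (if e \<le> d then a \<otimes> component (d - e) x else \<zero>)"
    and component_sum: "x \<in> carrier S \<Longrightarrow> \<exists>n. x = (\<Oplus>d\<in>{..n}. component d x)"
begin

lemma component_carrier [simp]: "x \<in> carrier S \<Longrightarrow> component d x \<in> carrier S"
  using component_grade grade_carrier by blast

lemma zero_grade: "\<zero> \<in> grade S d"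
proof (cases "d = 0")
  case True
  have "component (Suc 0) \<one> = \<zero>" using component_homogeneous[OF one_grade, of "Suc 0"] by simp
  then have "\<zero> \<in> grade S (Suc 0)" using component_grade[of \<one> "Suc 0"] by simp
  then have "component 0 \<zero> = \<zero>" using component_homogeneous[of \<zero> "Suc 0" 0] by simp
  then show ?thesis using component_grade[of \<zero> 0] True by simp
next
  case False
  then have "component d \<one> = \<zero>" using component_homogeneous[OF one_grade, of d] by simp
  then show ?thesis using component_grade[of \<one> d] by simp
qed

lemma component_zero [simp]: "component d \<zero> = \<zero>"
  using component_homogeneous[OF zero_grade, of d d] by simp

lemma finsum_closed_set:
  assumes "H \<subseteq> carrier S" "\<zero> \<in> H" "\<And>a b. a \<in> H \<Longrightarrow> b \<in> H \<Longrightarrow> a \<oplus> b \<in> H"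
    and "finite D" "\<And>d. d \<in> D \<Longrightarrow> f d \<in> H"
  shows "(\<Oplus>d\<in>D. f d) \<in> H"
  using assms(4,5)
proof (induction D rule: finite_induct)
  case empty
  then show ?case using assms(2) by simp
next
  case (insert x F)
  then have "f \<in> F \<rightarrow> carrier S" "f x \<in> carrier S" using assms(1) by auto
  then show ?case using insert assms(3) by (subst finsum_insert) auto
qed

text \<open>Every element is the sum of its components, so additively closed conditions pass from them to it.\<close>

lemma component_induct:
  assumes "x \<in> carrier S" "H \<subseteq> carrier S" "\<zero> \<in> H" "\<And>a b. a \<in> H \<Longrightarrow> b \<in> H \<Longrightarrow> a \<oplus> b \<in> H"
    and "\<And>d. component d x \<in> H"
  shows "x \<in> H"
proof -
  obtain n where "x = (\<Oplus>d\<in>{..n}. component d x)" using component_sum[OF assms(1)] by blast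
  moreover have "(\<Oplus>d\<in>{..n}. component d x) \<in> H"
    by (rule finsum_closed_set) (fact assms | simp add: assms(5))+
  ultimately show ?thesis by simp
qed

lemma ideal_component_induct:
  assumes "ideal P S" "x \<in> carrier S" "\<And>d. component d x \<in> P"
  shows "x \<in> P"
proof -
  interpret ideal P S by fact
  show ?thesis
    by (rule component_induct[OF assms(2) a_subset]) (simp_all add: assms(3))
qed

text \<open>The product \<open>r x\<close> is additive in \<open>r\<close>, so it suffices to multiply by the components of \<open>r\<close>.\<close>

lemma ideal_multiplier:
  assumes "additive_subgroup P S" "r \<in> carrier S"
    and "\<And>x d. x \<in> P \<Longrightarrow> component d r \<otimes> x \<in> P" "x \<in> P"
  shows "r \<otimes> x \<in> P"
proof -
  interpret additive_subgroup P S by fact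
  define H where "H = {r \<in> carrier S. \<forall>x\<in>P. r \<otimes> x \<in> P}"
  have "r \<in> H"
  proof (rule component_induct[OF assms(2)])
    show "H \<subseteq> carrier S" by (auto simp: H_def)
    show "\<zero> \<in> H" using a_Hcarr by (auto simp: H_def)
    show "a \<oplus> b \<in> H" if "a \<in> H" "b \<in> H" for a b
    proof -
      have "a \<in> carrier S" "b \<in> carrier S" using that by (auto simp: H_def)
      moreover have "(a \<oplus> b) \<otimes> x \<in> P" if "x \<in> P" for x
      proof -
        have "a \<otimes> x \<in> P" "b \<otimes> x \<in> P" using \<open>a \<in> H\<close> \<open>b \<in> H\<close> that by (auto simp: H_def)
        then have "a \<otimes> x \<oplus> b \<otimes> x \<in> P" by (rule a_closed)
        then show ?thesis using calculation a_Hcarr[OF that] by (simp add: l_distr)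
      qed
      ultimately show ?thesis by (simp add: H_def)
    qed
    show "component d r \<in> H" for d using assms by (auto simp: H_def)
  qed
  then show ?thesis using assms(4) by (auto simp: H_def)
qed

text \<open>
  Let \<open>P\<close> be generated by homogeneous elements. The elements of \<open>P\<close> all of whose components lie in
  \<open>P\<close> form an ideal that contains the generators, so it is all of \<open>P\<close>.
\<close>

lemma homogeneous_ideal_iff:
  "homogeneous_ideal P S \<longleftrightarrow> ideal P S \<and> (\<forall>x\<in>P. \<forall>d. component d x \<in> P)"
proof (intro iffI conjI)
  assume hom: "homogeneous_ideal P S"
  then show id: "ideal P S" by (simp add: homogeneous_ideal_def)
  interpret ideal P S by fact
  define P0 where "P0 = {x \<in> P. \<forall>d. component d x \<in> P}"
  have sub: "additive_subgroup P0 S"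
  proof (intro additive_subgroup.intro add.subgroupI)
    show "P0 \<subseteq> carrier S" using Icarr by (auto simp: P0_def)
    have "\<zero> \<in> P0" using additive_subgroup.zero_closed is_additive_subgroup by (auto simp: P0_def)
    then show "P0 \<noteq> {}" by blast
    show "\<ominus> x \<in> P0" if "x \<in> P0" for x
    proof -
      have "x \<in> P" "x \<in> carrier S" using that Icarr by (auto simp: P0_def)
      have "component d (\<ominus> x) = \<ominus> (component d x)" for d
      proof -
        have "component d (\<ominus> x) \<oplus> component d x = \<zero>"
          using component_add[of "\<ominus> x" x d] \<open>x \<in> carrier S\<close> by (simp add: l_neg)
        then show ?thesis using \<open>x \<in> carrier S\<close> by (simp add: minus_equality)
      qed
      moreover have "\<ominus> y \<in> P" if "y \<in> P" for y
        using that is_additive_subgroup by (simp add: additive_subgroup.a_inv_closed)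
      ultimately show ?thesis using that by (simp add: P0_def)
    qed
    show "x \<oplus> y \<in> P0" if "x \<in> P0" "y \<in> P0" for x y
      using that Icarr[of x] Icarr[of y] by (simp add: P0_def component_add)
  qed
  have "ideal P0 S"
  proof (rule idealI[OF ring_axioms])
    show "subgroup P0 (add_monoid S)" using sub by (rule additive_subgroup.a_subgroup)
    have l: "r \<otimes> x \<in> P0" if "x \<in> P0" "r \<in> carrier S" for x r
    proof (rule ideal_multiplier[OF sub \<open>r \<in> carrier S\<close> _ \<open>x \<in> P0\<close>])
      fix x d assume x: "x \<in> P0"
      then have "x \<in> carrier S" using Icarr by (auto simp: P0_def)
      then show "component d r \<otimes> x \<in> P0" using that x
        by (auto simp: P0_def component_mult[OF component_grade] intro!: I_l_closed)
    qed
    show "x \<otimes> a \<in> P0" if "a \<in> P0" "x \<in> carrier S" for a x using l that by blast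
    show "a \<otimes> x \<in> P0" if "a \<in> P0" "x \<in> carrier S" for a x
      using l[OF that] that Icarr by (auto simp: m_comm P0_def)
  qed
  moreover have "P \<inter> (\<Union>d. grade S d) \<subseteq> P0"
    by (auto simp: P0_def component_homogeneous)
  ultimately have "Idl (P \<inter> (\<Union>d. grade S d)) \<subseteq> P0" by (rule genideal_minimal)
  then show "\<forall>x\<in>P. \<forall>d. component d x \<in> P" using hom by (auto simp: homogeneous_ideal_def P0_def)
next
  assume "ideal P S \<and> (\<forall>x\<in>P. \<forall>d. component d x \<in> P)"
  then have id: "ideal P S" and c: "\<And>x d. x \<in> P \<Longrightarrow> component d x \<in> P" by auto
  interpret ideal P S by fact
  let ?H = "P \<inter> (\<Union>d. grade S d)"
  have sub: "?H \<subseteq> carrier S" using Icarr by auto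
  have "Idl ?H \<subseteq> P" using id by (intro genideal_minimal) auto
  moreover have "x \<in> Idl ?H" if "x \<in> P" for x
  proof (rule ideal_component_induct[OF genideal_ideal[OF sub]])
    show "x \<in> carrier S" using that Icarr by simp
    then have "component d x \<in> ?H" for d using c[OF that] component_grade by blast
    then show "component d x \<in> Idl ?H" for d using genideal_self[OF sub] by blast
  qed
  ultimately show "homogeneous_ideal P S" using id unfolding homogeneous_ideal_def by blast
qed

lemma proj_points_iff:
  "P \<in> proj_points S \<longleftrightarrow> primeideal P S \<and> (\<forall>x\<in>P. \<forall>d. component d x \<in> P)
     \<and> (\<exists>d>0. \<exists>h\<in>grade S d. h \<notin> P)"
proof -
  have "irrelevant_ideal S \<subseteq> P \<longleftrightarrow> (\<forall>d>0. grade S d \<subseteq> P)" if "ideal P S"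
  proof
    have sub: "(\<Union>d\<in>{0<..}. grade S d) \<subseteq> carrier S" using grade_carrier by auto
    show "\<forall>d>0. grade S d \<subseteq> P" if "irrelevant_ideal S \<subseteq> P"
      using genideal_self[OF sub] that unfolding irrelevant_ideal_def by auto
    show "irrelevant_ideal S \<subseteq> P" if "\<forall>d>0. grade S d \<subseteq> P"
      unfolding irrelevant_ideal_def by (rule genideal_minimal[OF \<open>ideal P S\<close>]) (use that in auto)
  qed
  then show ?thesis unfolding proj_points_def using homogeneous_ideal_iff primeideal.axioms(1) by blast
qed

lemma proj_point_prime:
  assumes "P \<in> proj_points S"
  shows "primeideal P S" "ideal P S" "P \<subseteq> carrier S" "\<one> \<notin> P"
    and "\<And>a b. a \<in> carrier S \<Longrightarrow> b \<in> carrier S \<Longrightarrow> a \<otimes> b \<in> P \<longleftrightarrow> a \<in> P \<or> b \<in> P"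
proof -
  show "primeideal P S" using assms by (simp add: proj_points_iff)
  then interpret primeideal P S .
  show "ideal P S" by (rule is_ideal)
  show "P \<subseteq> carrier S" by (rule a_subset)
  show "\<one> \<notin> P" using I_notcarr one_imp_carrier by blast
  show "a \<otimes> b \<in> P \<longleftrightarrow> a \<in> P \<or> b \<in> P" if "a \<in> carrier S" "b \<in> carrier S" for a b
    using that I_prime I_l_closed I_r_closed by blast
qed

lemma topspace_zariski: "topspace (zariski S) = proj_points S"
proof -
  have "basic_open S \<one> = proj_points S" using proj_point_prime(4) by (auto simp: basic_open_def)
  then show ?thesis
    unfolding zariski_def topology_generated_by_topspace using one_grade
    by (auto simp: basic_open_def)
qed

lemma openin_basic: "h \<in> grade S d \<Longrightarrow> openin (zariski S) (basic_open S h)"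
  unfolding zariski_def by (rule topology_generated_by_Basis) auto

text \<open>
  In a domain the auxiliary factor in the equality of fractions can be cancelled, because an
  element outside of \<open>P\<close> is not zero.
\<close>

lemma fraction_rel_iff:
  assumes "P \<in> proj_points S"
  shows "((a, f), (b, g)) \<in> fraction_rel S P \<longleftrightarrow>
    (a, f) \<in> fractions S P \<and> (b, g) \<in> fractions S P \<and> a \<otimes> g = b \<otimes> f"
proof -
  have "a \<otimes> g = b \<otimes> f" if "(a, f) \<in> fractions S P" "(b, g) \<in> fractions S P"
    "h \<in> (\<Union>d. grade S d) - P" "h \<otimes> (a \<otimes> g) = h \<otimes> (b \<otimes> f)" for h
  proof -
    have "\<zero> \<in> P" using proj_point_prime(2)[OF assms] additive_subgroup.zero_closed ideal.axioms(1) by blast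
    then have "h \<noteq> \<zero>" "h \<in> carrier S" using that grade_carrier by auto
    moreover have "a \<in> carrier S" "b \<in> carrier S" "f \<in> carrier S" "g \<in> carrier S"
      using that grade_carrier by (auto simp: fractions_def)
    ultimately show ?thesis using that(4) m_lcancel by auto
  qed
  moreover have "\<exists>h\<in>(\<Union>d. grade S d) - P. h \<otimes> (a \<otimes> g) = h \<otimes> (b \<otimes> f)" if "a \<otimes> g = b \<otimes> f"
    using that one_grade proj_point_prime(4)[OF assms] by auto
  ultimately show ?thesis unfolding fraction_rel_def by blast
qed

lemma fractionsD:
  assumes "(a, f) \<in> fractions S P"
  shows "a \<in> carrier S" "f \<in> carrier S" "f \<notin> P"
  using assms grade_carrier by (auto simp: fractions_def)

lemma fractions_mult:
  assumes "P \<in> proj_points S" "(a, f) \<in> fractions S P" "(b, g) \<in> fractions S P"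
  shows "(a \<otimes> b, f \<otimes> g) \<in> fractions S P"
proof -
  obtain d e where "a \<in> grade S d" "f \<in> grade S d" "b \<in> grade S e" "g \<in> grade S e"
    using assms by (auto simp: fractions_def)
  moreover have "f \<otimes> g \<notin> P"
    using proj_point_prime(5)[OF assms(1)] fractionsD[OF assms(2)] fractionsD[OF assms(3)] by simp
  ultimately show ?thesis unfolding fractions_def using grade_mult by blast
qed

lemma fractions_add:
  assumes "P \<in> proj_points S" "(a, f) \<in> fractions S P" "(b, g) \<in> fractions S P"
  shows "((a \<otimes> g) \<oplus> (b \<otimes> f), f \<otimes> g) \<in> fractions S P"
proof -
  obtain d e where *: "a \<in> grade S d" "f \<in> grade S d" "b \<in> grade S e" "g \<in> grade S e"
    using assms by (auto simp: fractions_def)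
  moreover have "f \<otimes> g \<notin> P"
    using proj_point_prime(5)[OF assms(1)] fractionsD[OF assms(2)] fractionsD[OF assms(3)] by simp
  moreover have "b \<otimes> f \<in> grade S (d + e)" using grade_mult[OF *(3) *(2)] by (simp add: add.commute)
  ultimately show ?thesis unfolding fractions_def using grade_mult grade_add by blast
qed

lemma equiv_fraction_rel:
  assumes P: "P \<in> proj_points S"
  shows "equiv (fractions S P) (fraction_rel S P)"
proof (rule equivI)
  show "refl_on (fractions S P) (fraction_rel S P)"
    by (rule refl_onI) (auto simp: fraction_rel_iff[OF P])
  show "fraction_rel S P \<subseteq> fractions S P \<times> fractions S P"
    by (auto simp: fraction_rel_def)
  show "sym (fraction_rel S P)"
    by (rule symI) (auto simp: fraction_rel_iff[OF P])
  show "trans (fraction_rel S P)"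
  proof (rule transI, clarify)
    fix a f b g c h
    assume 1: "((a, f), (b, g)) \<in> fraction_rel S P" and 2: "((b, g), (c, h)) \<in> fraction_rel S P"
    then have fr: "(a, f) \<in> fractions S P" "(b, g) \<in> fractions S P" "(c, h) \<in> fractions S P"
      and e: "a \<otimes> g = b \<otimes> f" "b \<otimes> h = c \<otimes> g" by (auto simp: fraction_rel_iff[OF P])
    note cs = fractionsD[OF fr(1)] fractionsD[OF fr(2)] fractionsD[OF fr(3)]
    have "\<zero> \<in> P" using proj_point_prime(2)[OF P] additive_subgroup.zero_closed ideal.axioms(1) by blast
    then have "g \<noteq> \<zero>" using cs by auto
    have "g \<otimes> (a \<otimes> h) = (a \<otimes> g) \<otimes> h" using cs by algebra
    also have "\<dots> = (b \<otimes> h) \<otimes> f" unfolding e(1) using cs by algebra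
    also have "\<dots> = g \<otimes> (c \<otimes> f)" unfolding e(2) using cs by algebra
    finally have "a \<otimes> h = c \<otimes> f" using \<open>g \<noteq> \<zero>\<close> cs m_lcancel by auto
    then show "((a, f), (c, h)) \<in> fraction_rel S P" using fr by (simp add: fraction_rel_iff[OF P])
  qed
qed

lemma fraction_self: "P \<in> proj_points S \<Longrightarrow> (a, f) \<in> fractions S P \<Longrightarrow> (a, f) \<in> fraction S P a f"
  unfolding fraction_def using equiv_class_self[OF equiv_fraction_rel] by blast

lemma fraction_mem_iff: "P \<in> proj_points S \<Longrightarrow> (b, g) \<in> fraction S P a f \<longleftrightarrow>
    (a, f) \<in> fractions S P \<and> (b, g) \<in> fractions S P \<and> a \<otimes> g = b \<otimes> f"
  by (simp add: fraction_def fraction_rel_iff)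

lemma fraction_eq_iff:
  assumes "P \<in> proj_points S" "(a, f) \<in> fractions S P" "(b, g) \<in> fractions S P"
  shows "fraction S P a f = fraction S P b g \<longleftrightarrow> a \<otimes> g = b \<otimes> f"
  unfolding fraction_def
  using eq_equiv_class_iff[OF equiv_fraction_rel[OF assms(1)] assms(2,3)] assms
  by (simp add: fraction_rel_iff)

lemma localization_carrierE:
  assumes "X \<in> carrier (hom_localization S P)"
  obtains a f where "(a, f) \<in> fractions S P" "X = fraction S P a f"
proof -
  have "X \<in> fractions S P // fraction_rel S P" using assms by (simp add: hom_localization_def)
  then obtain p where "p \<in> fractions S P" "X = fraction_rel S P `` {p}" by (rule quotientE)
  then show thesis using that[of "fst p" "snd p"] by (simp add: fraction_def)
qed

lemma fraction_closed: "(a, f) \<in> fractions S P \<Longrightarrow> fraction S P a f \<in> carrier (hom_localization S P)"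
  unfolding hom_localization_def fraction_def by (auto intro: quotientI)

lemma localization_mult:
  assumes P: "P \<in> proj_points S" and fr: "(a, f) \<in> fractions S P" "(b, g) \<in> fractions S P"
  shows "fraction S P a f \<otimes>\<^bsub>hom_localization S P\<^esub> fraction S P b g = fraction S P (a \<otimes> b) (f \<otimes> g)"
proof -
  have "fraction S P (a' \<otimes> b') (f' \<otimes> g') = fraction S P (a \<otimes> b) (f \<otimes> g)"
    if m: "(a', f') \<in> fraction S P a f" "(b', g') \<in> fraction S P b g" for a' f' b' g'
  proof -
    have fr': "(a', f') \<in> fractions S P" "(b', g') \<in> fractions S P"
      and e: "a \<otimes> f' = a' \<otimes> f" "b \<otimes> g' = b' \<otimes> g" using m by (auto simp: fraction_mem_iff[OF P])
    note cs = fractionsD[OF fr(1)] fractionsD[OF fr(2)] fractionsD[OF fr'(1)] fractionsD[OF fr'(2)]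
    have "(a' \<otimes> b') \<otimes> (f \<otimes> g) = (a' \<otimes> f) \<otimes> (b' \<otimes> g)" using cs by algebra
    also have "\<dots> = (a \<otimes> b) \<otimes> (f' \<otimes> g')" unfolding e[symmetric] using cs by algebra
    finally show ?thesis
      using fraction_eq_iff[OF P fractions_mult[OF P fr'] fractions_mult[OF P fr]] by simp
  qed
  from UN_pairs_constant[OF fraction_self[OF P fr(1)] fraction_self[OF P fr(2)] this]
  show ?thesis by (simp add: hom_localization_def)
qed

lemma localization_add:
  assumes P: "P \<in> proj_points S" and fr: "(a, f) \<in> fractions S P" "(b, g) \<in> fractions S P"
  shows "fraction S P a f \<oplus>\<^bsub>hom_localization S P\<^esub> fraction S P b g =
    fraction S P ((a \<otimes> g) \<oplus> (b \<otimes> f)) (f \<otimes> g)"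
proof -
  have "fraction S P ((a' \<otimes> g') \<oplus> (b' \<otimes> f')) (f' \<otimes> g') = fraction S P ((a \<otimes> g) \<oplus> (b \<otimes> f)) (f \<otimes> g)"
    if m: "(a', f') \<in> fraction S P a f" "(b', g') \<in> fraction S P b g" for a' f' b' g'
  proof -
    have fr': "(a', f') \<in> fractions S P" "(b', g') \<in> fractions S P"
      and e: "a \<otimes> f' = a' \<otimes> f" "b \<otimes> g' = b' \<otimes> g" using m by (auto simp: fraction_mem_iff[OF P])
    note cs = fractionsD[OF fr(1)] fractionsD[OF fr(2)] fractionsD[OF fr'(1)] fractionsD[OF fr'(2)]
    have "((a' \<otimes> g') \<oplus> (b' \<otimes> f')) \<otimes> (f \<otimes> g) = (a' \<otimes> f) \<otimes> (g \<otimes> g') \<oplus> (b' \<otimes> g) \<otimes> (f \<otimes> f')"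
      using cs by algebra
    also have "\<dots> = ((a \<otimes> g) \<oplus> (b \<otimes> f)) \<otimes> (f' \<otimes> g')" unfolding e[symmetric] using cs by algebra
    finally show ?thesis
      using fraction_eq_iff[OF P fractions_add[OF P fr'] fractions_add[OF P fr]] by simp
  qed
  from UN_pairs_constant[OF fraction_self[OF P fr(1)] fraction_self[OF P fr(2)] this]
  show ?thesis by (simp add: hom_localization_def)
qed

end

section \<open>Contraction of homogeneous primes\<close>

text \<open>
  An inclusion of graded \<open>k\<close>-algebras. It is given as an injective map \<open>\<iota>\<close>, because the elements of
  coordinate rings are cosets, and those of a subring are not cosets of the larger ring. In the
  comments, \<open>S\<close> is identified with its image.
\<close>

locale graded_extension =
  S: graded_domain S componentS + T: graded_domain T componentT
  for S :: "('a, 'k) graded_algebra" (structure) and componentS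
    and T :: "('b, 'k) graded_algebra" and componentT +
  fixes \<iota> :: "'a \<Rightarrow> 'b"
  assumes hom: "\<iota> \<in> ring_hom S T"
    and inj: "inj_on \<iota> (carrier S)"
    and hom_grade_iff: "a \<in> carrier S \<Longrightarrow> \<iota> a \<in> grade T d \<longleftrightarrow> a \<in> grade S d"
    and hom_component: "a \<in> carrier S \<Longrightarrow> \<iota> (componentS d a) = componentT d (\<iota> a)"
    and hom_scalar: "scalar S c \<in> grade S 0" "\<iota> (scalar S c) = scalar T c"
begin

definition contraction :: "'b set \<Rightarrow> 'a set" where
  "contraction P = {a \<in> carrier S. \<iota> a \<in> P}"

lemma hom_closed [simp]: "a \<in> carrier S \<Longrightarrow> \<iota> a \<in> carrier T"
  using ring_hom_closed[OF hom] .

lemma hom_mult: "a \<in> carrier S \<Longrightarrow> b \<in> carrier S \<Longrightarrow> \<iota> (a \<otimes> b) = \<iota> a \<otimes>\<^bsub>T\<^esub> \<iota> b"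
  using ring_hom_mult[OF hom] .

lemma hom_add: "a \<in> carrier S \<Longrightarrow> b \<in> carrier S \<Longrightarrow> \<iota> (a \<oplus> b) = \<iota> a \<oplus>\<^bsub>T\<^esub> \<iota> b"
  using ring_hom_add[OF hom] .

lemma hom_one: "\<iota> \<one> = \<one>\<^bsub>T\<^esub>"
  using ring_hom_one[OF hom] .

lemma hom_eq_iff: "a \<in> carrier S \<Longrightarrow> b \<in> carrier S \<Longrightarrow> \<iota> a = \<iota> b \<longleftrightarrow> a = b"
  using inj by (auto dest: inj_onD)

lemma hom_grade: "a \<in> grade S d \<Longrightarrow> \<iota> a \<in> grade T d"
  using hom_grade_iff S.grade_carrier by blast

lemma image_gradeE:
  assumes "b \<in> grade T d" "b \<in> \<iota> ` carrier S"
  obtains a where "a \<in> grade S d" "b = \<iota> a"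
  using assms hom_grade_iff by blast

text \<open>
  If \<open>y T \<subseteq> S\<close>, a prime \<open>Q\<close> of \<open>S\<close> not containing \<open>y\<close> is the contraction of \<open>{b \<in> T. y b \<in> Q}\<close>.
  That this set is a prime ideal follows from the same property of \<open>Q\<close>: a relation between elements
  of \<open>T\<close> can be multiplied by a power of \<open>y\<close> and read in \<open>S\<close>, and there the factor \<open>y\<close> can be removed
  again because \<open>Q\<close> is prime.
\<close>

lemma conductor_lying_over:
  assumes y: "y \<in> grade S e" "0 < e"
    and conductor: "\<And>b. b \<in> carrier T \<Longrightarrow> \<iota> y \<otimes>\<^bsub>T\<^esub> b \<in> \<iota> ` carrier S"
    and Q: "Q \<in> proj_points S" "y \<notin> Q"
  shows "\<exists>P\<in>proj_points T. contraction P = Q"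
proof -
  define P where "P = {b \<in> carrier T. \<exists>a\<in>Q. \<iota> a = \<iota> y \<otimes>\<^bsub>T\<^esub> b}"
  have yc [simp]: "y \<in> carrier S" using y S.grade_carrier by blast
  note Qprime = S.proj_point_prime[OF Q(1)]
  interpret Q: ideal Q S by (rule Qprime(2))
  have memP: "b \<in> P \<longleftrightarrow> a \<in> Q" if "a \<in> carrier S" "b \<in> carrier T" "\<iota> a = \<iota> y \<otimes>\<^bsub>T\<^esub> b" for a b
  proof
    assume "b \<in> P"
    then obtain a' where a': "a' \<in> Q" "\<iota> a' = \<iota> y \<otimes>\<^bsub>T\<^esub> b" by (auto simp: P_def)
    then have "a' = a" using that(1,3) Q.Icarr[OF a'(1)] by (simp add: hom_eq_iff[symmetric])
    then show "a \<in> Q" using a'(1) by simp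
  qed (use that in \<open>auto simp: P_def\<close>)
  have ex: "\<exists>a\<in>carrier S. \<iota> a = \<iota> y \<otimes>\<^bsub>T\<^esub> b" if "b \<in> carrier T" for b
    using conductor[OF that] by force
  have \<iota>P: "\<iota> a \<in> P \<longleftrightarrow> a \<in> Q" if "a \<in> carrier S" for a
  proof -
    have "\<iota> a \<in> P \<longleftrightarrow> y \<otimes> a \<in> Q" using that by (intro memP) (simp_all add: hom_mult)
    then show ?thesis using Qprime(5)[of y a] Q(2) that by simp
  qed
  have sub: "P \<subseteq> carrier T" by (auto simp: P_def)
  have zero: "\<zero>\<^bsub>T\<^esub> \<in> P"
  proof -
    have "\<iota> \<zero> = \<zero>\<^bsub>T\<^esub>"
      using hom ring_hom_zero[OF hom S.ring_axioms T.ring_axioms] by simp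
    moreover have "\<iota> \<zero> \<in> P" using \<iota>P[of \<zero>] Q.zero_closed by simp
    ultimately show ?thesis by simp
  qed
  have mult: "r \<otimes>\<^bsub>T\<^esub> b \<in> P" if r: "r \<in> carrier T" and b: "b \<in> P" for r b
  proof -
    have bT: "b \<in> carrier T" using b sub by blast
    obtain a where a: "a \<in> Q" "\<iota> a = \<iota> y \<otimes>\<^bsub>T\<^esub> b" using b by (auto simp: P_def)
    obtain c where c: "c \<in> carrier S" "\<iota> c = \<iota> y \<otimes>\<^bsub>T\<^esub> (r \<otimes>\<^bsub>T\<^esub> b)" using ex[of "r \<otimes>\<^bsub>T\<^esub> b"] r bT by auto
    obtain c' where c': "c' \<in> carrier S" "\<iota> c' = \<iota> y \<otimes>\<^bsub>T\<^esub> r" using ex[OF r] by auto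
    have ac: "a \<in> carrier S" using a(1) by (rule Q.Icarr)
    have "\<iota> (y \<otimes> c) = \<iota> (c' \<otimes> a)"
      using r bT ac by (simp add: hom_mult c c' a(2) T.m_ac)
    then have "y \<otimes> c = c' \<otimes> a" using c c' ac by (simp add: hom_eq_iff)
    then have "y \<otimes> c \<in> Q" using Q.I_l_closed[OF a(1) c'(1)] by simp
    then have "c \<in> Q" using Qprime(5)[of y c] c(1) Q(2) by simp
    then show ?thesis using memP[of c "r \<otimes>\<^bsub>T\<^esub> b"] c r bT by simp
  qed
  have add: "b \<oplus>\<^bsub>T\<^esub> b' \<in> P" if b: "b \<in> P" and b': "b' \<in> P" for b b'
  proof -
    have bT: "b \<in> carrier T" "b' \<in> carrier T" using b b' sub by auto
    obtain a where a: "a \<in> Q" "\<iota> a = \<iota> y \<otimes>\<^bsub>T\<^esub> b" using b by (auto simp: P_def)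
    obtain a' where a': "a' \<in> Q" "\<iota> a' = \<iota> y \<otimes>\<^bsub>T\<^esub> b'" using b' by (auto simp: P_def)
    have "\<iota> (a \<oplus> a') = \<iota> y \<otimes>\<^bsub>T\<^esub> (b \<oplus>\<^bsub>T\<^esub> b')"
      using a a' bT Q.Icarr by (simp add: hom_add T.r_distr)
    then show ?thesis using memP[of "a \<oplus> a'" "b \<oplus>\<^bsub>T\<^esub> b'"] a a' bT Q.Icarr Q.a_closed by simp
  qed
  have "ideal P T"
  proof (rule idealI[OF T.ring_axioms])
    show "subgroup P (add_monoid T)"
    proof (rule T.add.subgroupI[OF sub])
      show "P \<noteq> {}" using zero by blast
      show "\<ominus>\<^bsub>T\<^esub> b \<in> P" if b: "b \<in> P" for b
      proof -
        have "b \<in> carrier T" using b sub by blast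
        then have "\<ominus>\<^bsub>T\<^esub> b = (\<ominus>\<^bsub>T\<^esub> \<one>\<^bsub>T\<^esub>) \<otimes>\<^bsub>T\<^esub> b" by (simp add: T.l_minus)
        then show ?thesis using mult[OF _ b, of "\<ominus>\<^bsub>T\<^esub> \<one>\<^bsub>T\<^esub>"] by simp
      qed
    qed (rule add)
    show "r \<otimes>\<^bsub>T\<^esub> b \<in> P" if "b \<in> P" "r \<in> carrier T" for b r using mult that by blast
    show "b \<otimes>\<^bsub>T\<^esub> r \<in> P" if "b \<in> P" "r \<in> carrier T" for b r
    proof -
      have "b \<in> carrier T" using that sub by blast
      then show ?thesis using mult[OF that(2,1)] that by (simp add: T.m_comm)
    qed
  qed
  moreover have "carrier T \<noteq> P"
  proof -
    have "\<one>\<^bsub>T\<^esub> \<notin> P" using \<iota>P[of \<one>] Qprime(4) by (simp add: hom_one)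
    then show ?thesis using T.one_closed by blast
  qed
  moreover have "b \<in> P \<or> b' \<in> P" if b: "b \<in> carrier T" and b': "b' \<in> carrier T"
    and bb: "b \<otimes>\<^bsub>T\<^esub> b' \<in> P" for b b'
  proof -
    obtain a where a: "a \<in> Q" "\<iota> a = \<iota> y \<otimes>\<^bsub>T\<^esub> (b \<otimes>\<^bsub>T\<^esub> b')" using bb by (auto simp: P_def)
    have ac: "a \<in> carrier S" using a(1) by (rule Q.Icarr)
    obtain c where c: "c \<in> carrier S" "\<iota> c = \<iota> y \<otimes>\<^bsub>T\<^esub> b" using ex[OF b] by auto
    obtain c' where c': "c' \<in> carrier S" "\<iota> c' = \<iota> y \<otimes>\<^bsub>T\<^esub> b'" using ex[OF b'] by auto
    have "\<iota> (c \<otimes> c') = \<iota> (y \<otimes> a)"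
      using b b' ac c(1) c'(1) by (simp add: hom_mult c(2) c'(2) a(2) T.m_ac)
    then have "c \<otimes> c' = y \<otimes> a" using c c' ac by (simp add: hom_eq_iff)
    then have "c \<otimes> c' \<in> Q" using Q.I_l_closed[OF a(1) yc] by simp
    then have "c \<in> Q \<or> c' \<in> Q" using Qprime(5) c c' by simp
    then show ?thesis using memP[OF c(1) b c(2)] memP[OF c'(1) b' c'(2)] by simp
  qed
  ultimately have prime: "primeideal P T" by (intro primeidealI T.is_cring) auto
  have comps: "componentT d b \<in> P" if b: "b \<in> P" for b d
  proof -
    have bT: "b \<in> carrier T" using b sub by blast
    obtain a where a: "a \<in> Q" "\<iota> a = \<iota> y \<otimes>\<^bsub>T\<^esub> b" using b by (auto simp: P_def)
    have ac: "a \<in> carrier S" using a(1) by (rule Q.Icarr)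
    have "\<iota> (componentS (e + d) a) = \<iota> y \<otimes>\<^bsub>T\<^esub> componentT d b"
      using hom_component[OF ac, of "e + d"] T.component_mult[OF hom_grade[OF y(1)] bT, of "e + d"]
      by (simp add: a(2))
    moreover have "componentS (e + d) a \<in> Q" using a(1) Q(1) S.proj_points_iff by blast
    ultimately show ?thesis using memP[of "componentS (e + d) a" "componentT d b"] ac bT by simp
  qed
  have "\<iota> y \<notin> P" using \<iota>P[OF yc] Q(2) by simp
  then have "P \<in> proj_points T"
    unfolding T.proj_points_iff using prime comps y(2) hom_grade[OF y(1)] by blast
  moreover have "contraction P = Q"
    unfolding contraction_def using \<iota>P Q.Icarr by blast
  ultimately show ?thesis by blast
qed

end

text \<open>
  The first assumption says that the basic open sets given by elements of \<open>S\<close> are a basis of the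
  topology of Proj \<open>T\<close>: inside the basic open set of \<open>h\<close>, the point \<open>P\<close> has the smaller neighbourhood
  where \<open>h w\<close> does not vanish, and \<open>h w\<close> belongs to \<open>S\<close>. This makes contraction a topological
  embedding; the second assumption makes it surjective.
\<close>

locale proj_homeomorphism = graded_extension S componentS T componentT \<iota>
  for S :: "('a, 'k) graded_algebra" (structure) and componentS
    and T :: "('b, 'k) graded_algebra" and componentT and \<iota> +
  assumes common_denominator: "P \<in> proj_points T \<Longrightarrow> h \<in> grade T d \<Longrightarrow> h \<notin> P \<Longrightarrow>
      \<exists>e. \<exists>w\<in>grade T e. w \<notin> P \<and> h \<otimes>\<^bsub>T\<^esub> w \<in> \<iota> ` carrier S"
    and lying_over: "Q \<in> proj_points S \<Longrightarrow> \<exists>P\<in>proj_points T. contraction P = Q"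
begin

lemma common_denominatorE:
  assumes "P \<in> proj_points T" "h \<in> grade T d" "h \<notin> P"
  obtains w e g where "w \<in> grade T e" "w \<notin> P" "g \<in> grade S (d + e)" "\<iota> g = h \<otimes>\<^bsub>T\<^esub> w" "\<iota> g \<notin> P"
proof -
  obtain w e where w: "w \<in> grade T e" "w \<notin> P" "h \<otimes>\<^bsub>T\<^esub> w \<in> \<iota> ` carrier S"
    using common_denominator[OF assms] by blast
  then obtain g where "g \<in> grade S (d + e)" "\<iota> g = h \<otimes>\<^bsub>T\<^esub> w"
    using image_gradeE[OF T.grade_mult[OF assms(2) w(1)]] by metis
  moreover have "h \<otimes>\<^bsub>T\<^esub> w \<notin> P"
    using T.proj_point_prime(5)[OF assms(1)] T.grade_carrier assms w by blast
  ultimately show thesis using that w by metis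
qed

lemma contraction_proj_point:
  assumes P: "P \<in> proj_points T"
  shows "contraction P \<in> proj_points S"
  unfolding S.proj_points_iff
proof (intro conjI ballI allI)
  have "ring_hom_ring S T \<iota>"
    by (rule ring_hom_ringI2) (auto simp: hom S.ring_axioms T.ring_axioms)
  then show "primeideal (contraction P) S"
    unfolding contraction_def using S.cring_axioms T.proj_point_prime(1)[OF P]
    by (intro ring_hom_ring.primeideal_vimage) (auto simp: S.is_cring)
  show "componentS d x \<in> contraction P" if "x \<in> contraction P" for x d
    using that P by (auto simp: contraction_def hom_component T.proj_points_iff)
  obtain d h where "d > 0" "h \<in> grade T d" "h \<notin> P" using P T.proj_points_iff by blast
  then show "\<exists>d>0. \<exists>h\<in>grade S d. h \<notin> contraction P"
    using common_denominatorE[OF P]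
    by (metis (mono_tags, lifting) contraction_def mem_Collect_eq trans_less_add1)
qed

text \<open>
  Two points with the same contraction agree, since a homogeneous element that lies in only one of
  them has a multiple in \<open>S\<close> with the same property.
\<close>

lemma contraction_bij: "bij_betw contraction (proj_points T) (proj_points S)"
proof -
  have sub: "P \<subseteq> P'" if P: "P \<in> proj_points T" and P': "P' \<in> proj_points T"
    and eq: "contraction P = contraction P'" for P P'
  proof
    fix x assume "x \<in> P"
    then have "x \<in> carrier T" using T.proj_point_prime(3)[OF P] by blast
    show "x \<in> P'"
    proof (rule T.ideal_component_induct[OF T.proj_point_prime(2)[OF P'] \<open>x \<in> carrier T\<close>])
      fix d
      have x: "componentT d x \<in> grade T d" "componentT d x \<in> P"
        using \<open>x \<in> P\<close> P \<open>x \<in> carrier T\<close> by (auto simp: T.component_grade T.proj_points_iff)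
      show "componentT d x \<in> P'"
      proof (rule ccontr)
        assume "componentT d x \<notin> P'"
        then obtain w e g where w: "w \<in> grade T e" "g \<in> grade S (d + e)"
          "\<iota> g = componentT d x \<otimes>\<^bsub>T\<^esub> w" "\<iota> g \<notin> P'"
          using common_denominatorE[OF P' x(1)] by metis
        then have "\<iota> g \<in> P" using T.proj_point_prime(5)[OF P] x T.grade_carrier by metis
        then show False using eq w S.grade_carrier unfolding contraction_def by blast
      qed
    qed
  qed
  then have "inj_on contraction (proj_points T)"
    by (intro inj_onI equalityI) auto
  moreover have "contraction ` proj_points T = proj_points S"
    using contraction_proj_point lying_over by force
  ultimately show ?thesis by (simp add: bij_betw_def)
qed

lemma contraction_vimage_basic_open:
  "a \<in> carrier S \<Longrightarrow> {P \<in> proj_points T. contraction P \<in> basic_open S a} = basic_open T (\<iota> a)"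
  by (auto simp: basic_open_def contraction_proj_point) (auto simp: contraction_def)

lemma contraction_image_basic_open:
  assumes "h \<in> grade T d"
  shows "openin (zariski S) (contraction ` basic_open T h)"
proof (subst openin_subopen, intro ballI)
  fix Q assume "Q \<in> contraction ` basic_open T h"
  then obtain P where P: "P \<in> proj_points T" "h \<notin> P" "Q = contraction P"
    by (auto simp: basic_open_def)
  then obtain w e g where w: "w \<in> grade T e" "g \<in> grade S (d + e)" "\<iota> g = h \<otimes>\<^bsub>T\<^esub> w" "\<iota> g \<notin> P"
    using common_denominatorE assms by metis
  have "basic_open S g \<subseteq> contraction ` basic_open T h"
  proof
    fix Q' assume "Q' \<in> basic_open S g"
    then have Q': "Q' \<in> proj_points S" "g \<notin> Q'" by (auto simp: basic_open_def)
    then obtain P' where P': "P' \<in> proj_points T" "contraction P' = Q'" using lying_over by blast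
    then have "\<iota> g \<notin> P'" using Q' w S.grade_carrier unfolding contraction_def by blast
    then have "h \<notin> P'" using T.proj_point_prime(5)[OF P'(1)] w assms T.grade_carrier by metis
    then show "Q' \<in> contraction ` basic_open T h" using P' by (auto simp: basic_open_def)
  qed
  moreover have "Q \<in> basic_open S g"
    using P w contraction_proj_point by (auto simp: basic_open_def contraction_def)
  ultimately show "\<exists>U. openin (zariski S) U \<and> Q \<in> U \<and> U \<subseteq> contraction ` basic_open T h"
    using S.openin_basic[OF w(2)] by blast
qed

lemma homeomorphic_contraction: "homeomorphic_map (zariski T) (zariski S) contraction"
proof (rule bijective_open_imp_homeomorphic_map)
  have im: "contraction ` proj_points T = proj_points S" and inj: "inj_on contraction (proj_points T)"
    using contraction_bij by (auto simp: bij_betw_def)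
  show "contraction ` topspace (zariski T) = topspace (zariski S)"
    by (simp add: S.topspace_zariski T.topspace_zariski im)
  show "inj_on contraction (topspace (zariski T))"
    by (simp add: T.topspace_zariski inj)
  have "openin (zariski T) (contraction -` U \<inter> topspace (zariski T))"
    if U: "U \<in> {basic_open S f |f. f \<in> (\<Union>d. grade S d)}" for U
  proof -
    obtain f d where f: "f \<in> grade S d" "U = basic_open S f" using U by auto
    have "contraction -` U \<inter> topspace (zariski T) = basic_open T (\<iota> f)"
      using contraction_vimage_basic_open[OF S.grade_carrier[OF f(1)]] f(2)
      by (auto simp: T.topspace_zariski)
    then show ?thesis using T.openin_basic[OF hom_grade[OF f(1)]] by simp
  qed
  then show "continuous_map (zariski T) (zariski S) contraction"
    using im S.topspace_zariski T.topspace_zariski unfolding zariski_def[of S]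
    by (intro continuous_on_generated_topo) (simp_all only: topology_generated_by_topspace)
  show "open_map (zariski T) (zariski S) contraction"
    unfolding open_map_def
  proof (intro allI impI)
    fix U assume "openin (zariski T) U"
    then have "generate_topology_on {basic_open T f |f. f \<in> (\<Union>d. grade T d)} U"
      unfolding zariski_def openin_topology_generated_by_iff .
    then have "U \<subseteq> proj_points T \<and> openin (zariski S) (contraction ` U)"
    proof induction
      case Empty
      then show ?case by simp
    next
      case (Int a b)
      then have "contraction ` (a \<inter> b) = contraction ` a \<inter> contraction ` b"
        using inj by (meson inj_on_image_Int)
      then show ?case using Int by auto
    next
      case (UN K)
      then show ?case by (auto simp: image_Union)
    next
      case (Basis s)
      then show ?case using contraction_image_basic_open by (auto simp: basic_open_def[of T])
    qed
    then show "openin (zariski S) (contraction ` U)" ..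
  qed
qed

end

section \<open>Topological invariance of the dimension\<close>

text \<open>
  Being closed and irreducible is preserved by homeomorphisms, hence so are chains of irreducible
  closed sets and the Krull dimension.
\<close>

lemma homeomorphic_map_irreducible_closed:
  assumes "homeomorphic_map X Y f" "irreducible_closed X Z"
  shows "irreducible_closed Y (f ` Z)"
proof -
  obtain g where g: "homeomorphic_maps X Y f g" using assms(1) homeomorphic_map_maps by blast
  then have hg: "homeomorphic_map Y X g" using homeomorphic_maps_map by blast
  have gf: "\<And>x. x \<in> topspace X \<Longrightarrow> g (f x) = x" and fg: "\<And>y. y \<in> topspace Y \<Longrightarrow> f (g y) = y"
    using g by (auto simp: homeomorphic_maps_def)
  have Z: "closedin X Z" "Z \<noteq> {}" "\<And>A B. closedin X A \<Longrightarrow> closedin X B \<Longrightarrow> Z = A \<union> B \<Longrightarrow> Z = A \<or> Z = B"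
    using assms(2) by (auto simp: irreducible_closed_def)
  have Zs: "Z \<subseteq> topspace X" using Z(1) by (rule closedin_subset)
  have "f ` Z = A \<or> f ` Z = B" if AB: "closedin Y A" "closedin Y B" "f ` Z = A \<union> B" for A B
  proof -
    have sub: "A \<subseteq> topspace Y" "B \<subseteq> topspace Y" using AB closedin_subset by auto
    have "closedin X (g ` A)" "closedin X (g ` B)"
      using homeomorphic_map_closedness[OF hg] AB sub by auto
    moreover have "Z = g ` A \<union> g ` B"
    proof -
      have "Z = g ` f ` Z" using gf Zs by force
      then show ?thesis using AB(3) by (simp add: image_Un)
    qed
    ultimately have "Z = g ` A \<or> Z = g ` B" using Z(3) by blast
    moreover have "f ` g ` C = C" if "C \<subseteq> topspace Y" for C using fg that by force
    ultimately show ?thesis using sub by metis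
  qed
  moreover have "closedin Y (f ` Z)"
    using homeomorphic_map_closedness[OF assms(1) Zs] Z(1) by simp
  ultimately show ?thesis using Z(2) by (auto simp: irreducible_closed_def)
qed

lemma homeomorphic_map_krull_dim_le:
  assumes h: "homeomorphic_map X Y f"
  shows "krull_dim X \<le> krull_dim Y"
  unfolding krull_dim_def
proof (rule Sup_subset_mono, clarify)
  fix n and Z :: "nat \<Rightarrow> 'a set"
  assume Z: "\<forall>i\<le>n. irreducible_closed X (Z i)" "\<forall>i<n. Z i \<subset> Z (Suc i)"
  have sub: "Z i \<subseteq> topspace X" if "i \<le> n" for i
    using Z(1) that by (simp add: irreducible_closed_def closedin_subset)
  have "inj_on f (topspace X)" using h by (simp add: homeomorphic_map_def)
  then have "f ` Z i \<subset> f ` Z (Suc i)" if "i < n" for i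
    using that Z(2) sub[of "Suc i"] by (meson Suc_leI image_strict_mono inj_on_subset)
  then have "\<exists>W. (\<forall>i\<le>n. irreducible_closed Y (W i)) \<and> (\<forall>i<n. W i \<subset> W (Suc i))"
    using Z(1) homeomorphic_map_irreducible_closed[OF h] by (intro exI[of _ "\<lambda>i. f ` Z i"]) auto
  then show "\<exists>m. enat n = enat m \<and>
    (\<exists>W. (\<forall>i\<le>m. irreducible_closed Y (W i)) \<and> (\<forall>i<m. W i \<subset> W (Suc i)))" by auto
qed

lemma homeomorphic_map_krull_dim:
  assumes "homeomorphic_map X Y f"
  shows "krull_dim X = krull_dim Y"
  using assms homeomorphic_map_krull_dim_le
  by (meson homeomorphic_map_maps homeomorphic_maps_map order_antisym)

section \<open>Comparison of the structure sheaves\<close>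

lemma proj_section_locally:
  assumes "s \<in> carrier (proj_sections S U)" "P \<in> U"
  obtains V d a f where "openin (zariski S) V" "P \<in> V" "V \<subseteq> U" "a \<in> grade S d" "f \<in> grade S d"
    "\<And>Q. Q \<in> V \<Longrightarrow> f \<notin> Q" "\<And>Q. Q \<in> V \<Longrightarrow> s Q = fraction S Q a f"
proof -
  have "\<exists>V. openin (zariski S) V \<and> P \<in> V \<and> V \<subseteq> U \<and>
    (\<exists>d. \<exists>a\<in>grade S d. \<exists>f\<in>grade S d. \<forall>Q\<in>V. f \<notin> Q \<and> s Q = fraction S Q a f)"
    using assms by (simp add: proj_sections_def)
  then obtain V d a f where V: "openin (zariski S) V" "P \<in> V" "V \<subseteq> U" "a \<in> grade S d" "f \<in> grade S d"
    "\<forall>Q\<in>V. f \<notin> Q \<and> s Q = fraction S Q a f" by (elim exE conjE bexE)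
  show thesis by (rule that[OF V(1-5)]) (simp_all add: V(6))
qed

lemma proj_section_stalk:
  "s \<in> carrier (proj_sections S U) \<Longrightarrow> P \<in> U \<Longrightarrow> s P \<in> carrier (hom_localization S P)"
  by (auto simp: proj_sections_def)

context proj_homeomorphism
begin

text \<open>
  The image of a fraction, defined on equivalence classes as the union of the classes of the images
  of all representatives; all of them agree by the lemma \<open>stalk_map_fraction\<close> below.
\<close>

definition stalk_map :: "'b set \<Rightarrow> ('a \<times> 'a) set \<Rightarrow> ('b \<times> 'b) set" where
  "stalk_map P X = (\<Union>(a, f)\<in>X. fraction T P (\<iota> a) (\<iota> f))"

lemma hom_fractions:
  assumes "(a, f) \<in> fractions S (contraction P)"
  shows "(\<iota> a, \<iota> f) \<in> fractions T P"
proof -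
  obtain d where d: "a \<in> grade S d" "f \<in> grade S d" and f: "f \<notin> contraction P"
    using assms by (auto simp: fractions_def)
  then have "\<iota> f \<notin> P" using S.grade_carrier by (auto simp: contraction_def)
  then show ?thesis using hom_grade[OF d(1)] hom_grade[OF d(2)] by (auto simp: fractions_def)
qed

lemma stalk_map_fraction:
  assumes P: "P \<in> proj_points T" and fr: "(a, f) \<in> fractions S (contraction P)"
  shows "stalk_map P (fraction S (contraction P) a f) = fraction T P (\<iota> a) (\<iota> f)"
proof -
  note Q = contraction_proj_point[OF P]
  have "(case x of (b, g) \<Rightarrow> fraction T P (\<iota> b) (\<iota> g)) = fraction T P (\<iota> a) (\<iota> f)"
    if x: "x \<in> fraction S (contraction P) a f" for x
  proof -
    obtain b g where [simp]: "x = (b, g)" by (cases x)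
    have fr': "(b, g) \<in> fractions S (contraction P)" and e: "a \<otimes> g = b \<otimes> f"
      using x by (auto simp: S.fraction_mem_iff[OF Q])
    have "\<iota> b \<otimes>\<^bsub>T\<^esub> \<iota> f = \<iota> a \<otimes>\<^bsub>T\<^esub> \<iota> g"
      using e S.fractionsD[OF fr] S.fractionsD[OF fr'] by (metis hom_mult)
    then show ?thesis
      by (simp add: T.fraction_eq_iff[OF P hom_fractions[OF fr'] hom_fractions[OF fr]])
  qed
  moreover have "(a, f) \<in> fraction S (contraction P) a f" by (rule S.fraction_self[OF Q fr])
  ultimately show ?thesis
    unfolding stalk_map_def by (intro UN_constant_eq ballI)
qed

lemma stalk_map_closed:
  assumes P: "P \<in> proj_points T" and X: "X \<in> carrier (hom_localization S (contraction P))"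
  shows "stalk_map P X \<in> carrier (hom_localization T P)"
proof -
  obtain a f where "(a, f) \<in> fractions S (contraction P)" "X = fraction S (contraction P) a f"
    using S.localization_carrierE[OF X] .
  then show ?thesis by (simp add: stalk_map_fraction[OF P] T.fraction_closed hom_fractions)
qed

lemma stalk_map_mult:
  assumes P: "P \<in> proj_points T"
    and X: "X \<in> carrier (hom_localization S (contraction P))"
    and Y: "Y \<in> carrier (hom_localization S (contraction P))"
  shows "stalk_map P (X \<otimes>\<^bsub>hom_localization S (contraction P)\<^esub> Y) =
    stalk_map P X \<otimes>\<^bsub>hom_localization T P\<^esub> stalk_map P Y"
proof -
  note Q = contraction_proj_point[OF P]
  obtain a f where 1: "(a, f) \<in> fractions S (contraction P)" "X = fraction S (contraction P) a f"
    using S.localization_carrierE[OF X] .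
  obtain b g where 2: "(b, g) \<in> fractions S (contraction P)" "Y = fraction S (contraction P) b g"
    using S.localization_carrierE[OF Y] .
  show ?thesis
    using S.fractionsD[OF 1(1)] S.fractionsD[OF 2(1)]
    by (simp add: 1(2) 2(2) S.localization_mult[OF Q 1(1) 2(1)] stalk_map_fraction[OF P] 1(1) 2(1)
        S.fractions_mult[OF Q] T.localization_mult[OF P] hom_fractions hom_mult)
qed

lemma stalk_map_add:
  assumes P: "P \<in> proj_points T"
    and X: "X \<in> carrier (hom_localization S (contraction P))"
    and Y: "Y \<in> carrier (hom_localization S (contraction P))"
  shows "stalk_map P (X \<oplus>\<^bsub>hom_localization S (contraction P)\<^esub> Y) =
    stalk_map P X \<oplus>\<^bsub>hom_localization T P\<^esub> stalk_map P Y"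
proof -
  note Q = contraction_proj_point[OF P]
  obtain a f where 1: "(a, f) \<in> fractions S (contraction P)" "X = fraction S (contraction P) a f"
    using S.localization_carrierE[OF X] .
  obtain b g where 2: "(b, g) \<in> fractions S (contraction P)" "Y = fraction S (contraction P) b g"
    using S.localization_carrierE[OF Y] .
  show ?thesis
    using S.fractionsD[OF 1(1)] S.fractionsD[OF 2(1)]
    by (simp add: 1(2) 2(2) S.localization_add[OF Q 1(1) 2(1)] stalk_map_fraction[OF P] 1(1) 2(1)
        S.fractions_add[OF Q] T.localization_add[OF P] hom_fractions hom_mult hom_add)
qed

lemma stalk_map_scalar:
  assumes P: "P \<in> proj_points T" and a: "a \<in> grade S 0"
  shows "stalk_map P (fraction S (contraction P) a \<one>) = fraction T P (\<iota> a) \<one>\<^bsub>T\<^esub>"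
proof -
  have "(a, \<one>) \<in> fractions S (contraction P)"
    using a S.one_grade S.proj_point_prime(4)[OF contraction_proj_point[OF P]]
    by (auto simp: fractions_def)
  then show ?thesis by (simp add: stalk_map_fraction[OF P] hom_one)
qed

lemma stalk_map_one:
  assumes P: "P \<in> proj_points T"
  shows "stalk_map P \<one>\<^bsub>hom_localization S (contraction P)\<^esub> = \<one>\<^bsub>hom_localization T P\<^esub>"
proof -
  have "\<one>\<^bsub>hom_localization S (contraction P)\<^esub> = fraction S (contraction P) \<one> \<one>"
    "\<one>\<^bsub>hom_localization T P\<^esub> = fraction T P \<one>\<^bsub>T\<^esub> \<one>\<^bsub>T\<^esub>" by (simp_all add: hom_localization_def)
  then show ?thesis using stalk_map_scalar[OF P S.one_grade] by (simp only: hom_one)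
qed

lemma stalk_map_inj:
  assumes P: "P \<in> proj_points T"
  shows "inj_on (stalk_map P) (carrier (hom_localization S (contraction P)))"
proof (rule inj_onI)
  note Q = contraction_proj_point[OF P]
  fix X Y
  assume X: "X \<in> carrier (hom_localization S (contraction P))"
    and Y: "Y \<in> carrier (hom_localization S (contraction P))" and eq: "stalk_map P X = stalk_map P Y"
  obtain a f where 1: "(a, f) \<in> fractions S (contraction P)" "X = fraction S (contraction P) a f"
    using S.localization_carrierE[OF X] .
  obtain b g where 2: "(b, g) \<in> fractions S (contraction P)" "Y = fraction S (contraction P) b g"
    using S.localization_carrierE[OF Y] .
  have "\<iota> a \<otimes>\<^bsub>T\<^esub> \<iota> g = \<iota> b \<otimes>\<^bsub>T\<^esub> \<iota> f"
    using eq unfolding 1(2) 2(2) stalk_map_fraction[OF P 1(1)] stalk_map_fraction[OF P 2(1)]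
    by (simp add: T.fraction_eq_iff[OF P hom_fractions[OF 1(1)] hom_fractions[OF 2(1)]])
  then have "a \<otimes> g = b \<otimes> f"
    using S.fractionsD[OF 1(1)] S.fractionsD[OF 2(1)] by (simp add: hom_mult[symmetric] hom_eq_iff)
  then show "X = Y" using S.fraction_eq_iff[OF Q 1(1) 2(1)] 1 2 by simp
qed

lemma openin_contraction_vimage:
  assumes "openin (zariski S) V"
  shows "openin (zariski T) {P \<in> proj_points T. contraction P \<in> V}"
  using openin_continuous_map_preimage[OF homeomorphic_imp_continuous_map[OF homeomorphic_contraction] assms]
  by (simp only: T.topspace_zariski)

lemma openin_contraction_image:
  assumes "openin (zariski T) U"
  shows "openin (zariski S) (contraction ` U)"
  using homeomorphic_imp_open_map[OF homeomorphic_contraction] assms unfolding open_map_def by blast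

definition section_map ::
    "'a set set \<Rightarrow> ('a set \<Rightarrow> ('a \<times> 'a) set) \<Rightarrow> ('b set \<Rightarrow> ('b \<times> 'b) set)" where
  "section_map V s =
    (\<lambda>P\<in>{P \<in> proj_points T. contraction P \<in> V}. stalk_map P (s (contraction P)))"

lemma section_map_closed:
  assumes s: "s \<in> carrier (proj_sections S V)"
  shows "section_map V s \<in> carrier (proj_sections T {P \<in> proj_points T. contraction P \<in> V})"
    (is "_ \<in> carrier (proj_sections T ?W)")
proof -
  note sV = proj_section_stalk[OF s]
  have "section_map V s \<in> (\<Pi>\<^sub>E P\<in>?W. carrier (hom_localization T P))"
    unfolding section_map_def by (auto intro!: stalk_map_closed sV)
  moreover have "\<exists>U. openin (zariski T) U \<and> P \<in> U \<and> U \<subseteq> ?W \<and>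
      (\<exists>d. \<exists>a\<in>grade T d. \<exists>f\<in>grade T d. \<forall>Q\<in>U. f \<notin> Q \<and> section_map V s Q = fraction T Q a f)"
    if "P \<in> ?W" for P
  proof -
    have "contraction P \<in> V" using that by simp
    from this obtain U d a f where U: "openin (zariski S) U" "contraction P \<in> U" "U \<subseteq> V"
      "a \<in> grade S d" "f \<in> grade S d" "\<And>Q. Q \<in> U \<Longrightarrow> f \<notin> Q" "\<And>Q. Q \<in> U \<Longrightarrow> s Q = fraction S Q a f"
      by (rule proj_section_locally[OF s]) (rule that)
    define U' where "U' = {P \<in> proj_points T. contraction P \<in> U}"
    have o: "openin (zariski T) U'" unfolding U'_def by (rule openin_contraction_vimage[OF U(1)])
    have m: "P \<in> U'" "U' \<subseteq> ?W" using U that by (auto simp: U'_def)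
    have l: "\<iota> f \<notin> P' \<and> section_map V s P' = fraction T P' (\<iota> a) (\<iota> f)" if "P' \<in> U'" for P'
    proof -
      have P': "P' \<in> proj_points T" "contraction P' \<in> U" using that by (auto simp: U'_def)
      then have "f \<notin> contraction P'" using U(6) by blast
      then have "(a, f) \<in> fractions S (contraction P')" using U by (auto simp: fractions_def)
      moreover have "\<iota> f \<notin> P'" using \<open>f \<notin> contraction P'\<close> S.grade_carrier[OF U(5)]
        by (auto simp: contraction_def)
      ultimately show ?thesis
        using P' U(3) by (auto simp: section_map_def U(7) stalk_map_fraction)
    qed
    show ?thesis
      by (intro exI[of _ U'] exI[of _ d] bexI[OF _ hom_grade[OF U(4)]] bexI[OF _ hom_grade[OF U(5)]]
          conjI[OF o] conjI[OF m(1)] conjI[OF m(2)] ballI l)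
  qed
  ultimately show ?thesis by (simp add: proj_sections_def)
qed

lemma section_map_inj:
  assumes V: "V \<subseteq> proj_points S"
  shows "inj_on (section_map V) (carrier (proj_sections S V))"
proof (rule inj_onI)
  fix s t assume s: "s \<in> carrier (proj_sections S V)" and t: "t \<in> carrier (proj_sections S V)"
    and eq: "section_map V s = section_map V t"
  have "s Q = t Q" if Q: "Q \<in> V" for Q
  proof -
    obtain P where P: "P \<in> proj_points T" "contraction P = Q" using lying_over V Q by blast
    have "stalk_map P (s Q) = stalk_map P (t Q)"
      using fun_cong[OF eq, of P] P Q by (simp add: section_map_def)
    moreover have "s Q \<in> carrier (hom_localization S Q)" "t Q \<in> carrier (hom_localization S Q)"
      using s t Q by (auto simp: proj_sections_def)
    ultimately show ?thesis using stalk_map_inj[OF P(1)] P(2) by (auto dest: inj_onD)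
  qed
  moreover have "s \<in> (\<Pi>\<^sub>E P\<in>V. carrier (hom_localization S P))"
    "t \<in> (\<Pi>\<^sub>E P\<in>V. carrier (hom_localization S P))"
    using s t by (auto simp: proj_sections_def)
  ultimately show "s = t" by (rule_tac PiE_ext) auto
qed

text \<open>
  Surjectivity is where \<open>y T \<subseteq> S\<close> enters: a section that is locally \<open>b/g\<close> over Proj \<open>T\<close> is also
  \<open>(y b)/(y g)\<close> where \<open>y\<close> does not vanish, and both \<open>y b\<close> and \<open>y g\<close> come from \<open>S\<close>. Since the maps on
  stalks are injective, these local preimages are determined by the section and fit together.
\<close>

lemma section_map_surj:
  assumes y: "y \<in> grade S e" and conductor: "\<And>b. b \<in> carrier T \<Longrightarrow> \<iota> y \<otimes>\<^bsub>T\<^esub> b \<in> \<iota> ` carrier S"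
    and V: "V \<subseteq> basic_open S y"
    and t: "t \<in> carrier (proj_sections T {P \<in> proj_points T. contraction P \<in> V})" 
  shows "t \<in> section_map V ` carrier (proj_sections S V)"
proof -
  let ?W = "{P \<in> proj_points T. contraction P \<in> V}"
  define pre where "pre P = inv_into (carrier (hom_localization S (contraction P))) (stalk_map P) (t P)" for P
  define s where "s = (\<lambda>Q\<in>V. pre (inv_into (proj_points T) contraction Q))"
  have inj: "inj_on contraction (proj_points T)" using contraction_bij by (simp add: bij_betw_def)
  have s_pre: "s (contraction P) = pre P" if "P \<in> ?W" for P
    using that inj by (simp add: s_def)
  have loc: "\<exists>U. openin (zariski S) U \<and> contraction P \<in> U \<and> U \<subseteq> V \<and> (\<exists>d. \<exists>a\<in>grade S d. \<exists>f\<in>grade S d.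
      \<forall>P'\<in>?W. contraction P' \<in> U \<longrightarrow> f \<notin> contraction P' \<and> (a, f) \<in> fractions S (contraction P') \<and>
        s (contraction P') = fraction S (contraction P') a f \<and> t P' = fraction T P' (\<iota> a) (\<iota> f))"
    if "P \<in> ?W" for P
  proof -
    obtain U d b g where U: "openin (zariski T) U" "P \<in> U" "U \<subseteq> ?W"
      "b \<in> grade T d" "g \<in> grade T d" "\<And>P. P \<in> U \<Longrightarrow> g \<notin> P" "\<And>P. P \<in> U \<Longrightarrow> t P = fraction T P b g"
      by (rule proj_section_locally[OF t \<open>P \<in> ?W\<close>]) (rule that)
    note gc = T.grade_carrier[OF U(4)] T.grade_carrier[OF U(5)]
    note yT = hom_grade[OF y]
    obtain a where a: "a \<in> grade S (e + d)" "\<iota> a = \<iota> y \<otimes>\<^bsub>T\<^esub> b"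
      using image_gradeE[OF T.grade_mult[OF yT U(4)] conductor[OF gc(1)]] by metis
    obtain f where f: "f \<in> grade S (e + d)" "\<iota> f = \<iota> y \<otimes>\<^bsub>T\<^esub> g"
      using image_gradeE[OF T.grade_mult[OF yT U(5)] conductor[OF gc(2)]] by metis
    have o: "openin (zariski S) (contraction ` U)" by (rule openin_contraction_image[OF U(1)])
    have l: "f \<notin> contraction P' \<and> (a, f) \<in> fractions S (contraction P') \<and>
        s (contraction P') = fraction S (contraction P') a f \<and> t P' = fraction T P' (\<iota> a) (\<iota> f)"
      if P'W: "P' \<in> ?W" and P'U: "contraction P' \<in> contraction ` U" for P'
    proof -
      have P': "P' \<in> proj_points T" using P'W by simp
      have PU: "P' \<in> U" using inj P'U P' U(3) by (auto dest: inj_onD)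
      have "y \<notin> contraction P'" using P'W V by (auto simp: basic_open_def)
      then have yP: "\<iota> y \<notin> P'" using S.grade_carrier[OF y] by (simp add: contraction_def)
      then have "\<iota> f \<notin> P'"
        using T.proj_point_prime(5)[OF P'] f(2) U(6)[OF PU] gc T.grade_carrier[OF yT] by simp
      then have fP: "f \<notin> contraction P'" by (simp add: contraction_def)
      then have fr: "(a, f) \<in> fractions S (contraction P')" using a f by (auto simp: fractions_def)
      have fr': "(b, g) \<in> fractions T P'" using U PU by (auto simp: fractions_def)
      have "t P' = fraction T P' (\<iota> a) (\<iota> f)"
        unfolding U(7)[OF PU] T.fraction_eq_iff[OF P' fr' hom_fractions[OF fr]]
        using gc T.grade_carrier[OF yT] by (simp add: a(2) f(2) T.m_lcomm T.m_comm)
      moreover from this have "pre P' = fraction S (contraction P') a f"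
        unfolding pre_def
        by (intro inv_into_f_eq[OF stalk_map_inj[OF P'] S.fraction_closed[OF fr]])
          (simp add: stalk_map_fraction[OF P' fr])
      ultimately show ?thesis using fP fr s_pre[OF P'W] by simp
    qed
    have m: "contraction P \<in> contraction ` U" "contraction ` U \<subseteq> V" using U(2,3) by auto
    show ?thesis
      by (intro exI[of _ "contraction ` U"] exI[of _ "e + d"] bexI[OF _ a(1)] bexI[OF _ f(1)]
          conjI[OF o] conjI[OF m(1)] conjI[OF m(2)] ballI impI l)
  qed
  have over: "\<exists>P\<in>?W. contraction P = Q" if "Q \<in> V" for Q
    using lying_over[of Q] V that by (auto simp: basic_open_def)
  have "s Q \<in> carrier (hom_localization S Q)" if Q: "Q \<in> V" for Q
  proof -
    obtain P where "P \<in> ?W" "contraction P = Q" using over[OF Q] by blast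
    then obtain a f where "(a, f) \<in> fractions S Q" "s Q = fraction S Q a f" using loc[of P] by blast
    then show ?thesis by (simp add: S.fraction_closed)
  qed
  moreover have "\<exists>U. openin (zariski S) U \<and> Q \<in> U \<and> U \<subseteq> V \<and>
      (\<exists>d. \<exists>a\<in>grade S d. \<exists>f\<in>grade S d. \<forall>Q'\<in>U. f \<notin> Q' \<and> s Q' = fraction S Q' a f)" if Q: "Q \<in> V" for Q
  proof -
    obtain P where P: "P \<in> ?W" "contraction P = Q" using over[OF Q] by blast
    obtain U d a f where U: "openin (zariski S) U" "Q \<in> U" "U \<subseteq> V" "a \<in> grade S d" "f \<in> grade S d"
      "\<forall>P'\<in>?W. contraction P' \<in> U \<longrightarrow> f \<notin> contraction P' \<and> (a, f) \<in> fractions S (contraction P') \<and>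
        s (contraction P') = fraction S (contraction P') a f \<and> t P' = fraction T P' (\<iota> a) (\<iota> f)"
      using loc[OF P(1)] unfolding P(2) by (elim exE conjE bexE)
    have "f \<notin> Q' \<and> s Q' = fraction S Q' a f" if Q': "Q' \<in> U" for Q'
    proof -
      obtain P' where P': "P' \<in> ?W" "contraction P' = Q'"
        using over[OF subsetD[OF U(3) Q']] by blast
      show ?thesis using bspec[OF U(6) P'(1)] P'(2) Q' by simp
    qed
    then show ?thesis
      by (intro exI[of _ U] exI[of _ d] bexI[OF _ U(4)] bexI[OF _ U(5)]
          conjI[OF U(1)] conjI[OF U(2)] conjI[OF U(3)] ballI)
  qed
  moreover have "s \<in> extensional V" by (simp add: s_def)
  ultimately have "s \<in> carrier (proj_sections S V)" by (simp add: proj_sections_def PiE_def)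
  moreover have "section_map V s = t"
  proof (rule ext)
    fix P show "section_map V s P = t P"
    proof (cases "P \<in> ?W")
      case True
      then obtain a f where "(a, f) \<in> fractions S (contraction P)"
        "s (contraction P) = fraction S (contraction P) a f" "t P = fraction T P (\<iota> a) (\<iota> f)"
        using loc[OF True] by blast
      then show ?thesis using True by (simp add: section_map_def stalk_map_fraction)
    next
      case False
      have "t \<in> extensional ?W" using t by (simp add: proj_sections_def PiE_def)
      moreover have "section_map V s \<in> extensional ?W"
        unfolding section_map_def by (rule restrict_extensional)
      ultimately show ?thesis using False by (simp only: extensional_arb[OF _ False])
    qed
  qed
  ultimately show ?thesis by blast
qed

lemma section_map_iso:
  assumes y: "y \<in> grade S e" and conductor: "\<And>b. b \<in> carrier T \<Longrightarrow> \<iota> y \<otimes>\<^bsub>T\<^esub> b \<in> \<iota> ` carrier S"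
    and V: "V \<subseteq> basic_open S y"
  shows "section_map V \<in> ring_iso (proj_sections S V)
    (proj_sections T {P \<in> proj_points T. contraction P \<in> V})" (is "_ \<in> ring_iso _ ?R")
proof -
  note sV = proj_section_stalk
  have "section_map V \<in> ring_hom (proj_sections S V) ?R"
  proof (rule ring_hom_memI)
    fix s assume s: "s \<in> carrier (proj_sections S V)"
    show "section_map V s \<in> carrier ?R" by (rule section_map_closed[OF s])
    fix t assume t: "t \<in> carrier (proj_sections S V)"
    show "section_map V (s \<otimes>\<^bsub>proj_sections S V\<^esub> t) = section_map V s \<otimes>\<^bsub>?R\<^esub> section_map V t"
      by (rule ext) (simp add: proj_sections_def section_map_def stalk_map_mult sV[OF s] sV[OF t])
    show "section_map V (s \<oplus>\<^bsub>proj_sections S V\<^esub> t) = section_map V s \<oplus>\<^bsub>?R\<^esub> section_map V t"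
      by (rule ext) (simp add: proj_sections_def section_map_def stalk_map_add sV[OF s] sV[OF t])
  next
    show "section_map V \<one>\<^bsub>proj_sections S V\<^esub> = \<one>\<^bsub>?R\<^esub>"
      by (rule ext) (simp add: proj_sections_def section_map_def stalk_map_one)
  qed
  moreover have "V \<subseteq> proj_points S" using V by (auto simp: basic_open_def)
  then have "bij_betw (section_map V) (carrier (proj_sections S V)) (carrier ?R)"
    unfolding bij_betw_def
    using section_map_inj section_map_closed section_map_surj[OF y conductor V] by blast
  ultimately show ?thesis by (simp add: ring_iso_def)
qed

text \<open>
  Away from the conductor a graded extension does not change Proj: contraction restricts to a
  homeomorphism between the open sets where \<open>y\<close> does not vanish, and the maps on sections are
  isomorphisms by the preceding lemmas.
\<close>

theorem isomorphic_over_basic_open: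
  assumes y: "y \<in> grade S e" and conductor: "\<And>b. b \<in> carrier T \<Longrightarrow> \<iota> y \<otimes>\<^bsub>T\<^esub> b \<in> \<iota> ` carrier S"
  shows "isomorphic_over (open_subspace (Proj T) (basic_open T (\<iota> y)))
    (open_subspace (Proj S) (basic_open S y))"
proof -
  let ?X = "open_subspace (Proj T) (basic_open T (\<iota> y))"
  let ?X' = "open_subspace (Proj S) (basic_open S y)"
  have yc: "y \<in> carrier S" using S.grade_carrier[OF y] .
  have vimage: "basic_open T (\<iota> y) = {P \<in> proj_points T. contraction P \<in> basic_open S y}"
    using contraction_vimage_basic_open[OF yc] by simp
  have "contraction ` basic_open T (\<iota> y) = basic_open S y"
  proof (intro equalityI subsetI)
    fix Q assume Q: "Q \<in> basic_open S y"
    then obtain P where "P \<in> proj_points T" "contraction P = Q"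
      using lying_over[of Q] by (auto simp: basic_open_def)
    then show "Q \<in> contraction ` basic_open T (\<iota> y)" using Q unfolding vimage by blast
  qed (auto simp: vimage)
  moreover have "basic_open T (\<iota> y) \<subseteq> proj_points T" "basic_open S y \<subseteq> proj_points S"
    by (auto simp: basic_open_def)
  ultimately have "contraction ` (topspace (zariski T) \<inter> basic_open T (\<iota> y)) =
      topspace (zariski S) \<inter> basic_open S y"
    by (simp add: S.topspace_zariski T.topspace_zariski Int_absorb1)
  then have "homeomorphic_map (space_top ?X) (space_top ?X') contraction"
    using homeomorphic_map_subtopologies[OF homeomorphic_contraction]
    by (simp add: open_subspace_def Proj_def)
  moreover have V: "V \<subseteq> basic_open S y" "preim ?X contraction V = {P \<in> proj_points T. contraction P \<in> V}"
    if "openin (space_top ?X') V" for V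
  proof -
    show V: "V \<subseteq> basic_open S y"
      using openin_subset[OF that] by (auto simp: open_subspace_def Proj_def)
    show "preim ?X contraction V = {P \<in> proj_points T. contraction P \<in> V}"
      using V by (auto simp: preim_def open_subspace_def Proj_def T.topspace_zariski vimage)
  qed
  moreover have "section_map V (const ?X' V c) = const ?X {P \<in> proj_points T. contraction P \<in> V} c" for V c
    by (rule ext) (simp add: section_map_def open_subspace_def Proj_def stalk_map_scalar hom_scalar)
  moreover have "section_map W (restr ?X' V W s) =
      restr ?X {P \<in> proj_points T. contraction P \<in> V} {P \<in> proj_points T. contraction P \<in> W} (section_map V s)"
    if "W \<subseteq> V" for V W s
    using that by (intro ext) (auto simp: section_map_def open_subspace_def Proj_def)
  moreover have "section_map V \<in> ring_iso (sections ?X' V) (sections ?X {P \<in> proj_points T. contraction P \<in> V})"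
    if "V \<subseteq> basic_open S y" for V
    using section_map_iso[OF y conductor that] by (simp add: open_subspace_def Proj_def)
  ultimately show ?thesis
    unfolding isomorphic_over_def
    by (intro exI[of _ contraction] exI[of _ section_map]) simp
qed

end

section \<open>Graded subrings of polynomial rings\<close>

text \<open>
  All ring identities can be checked after an injective map to a ring given by a type class. The
  polynomial rings and their quotients below both obtain their ring structure in this way.
\<close>

lemma cring_of_embedding:
  fixes R :: "('a, 'm) ring_scheme" (structure) and \<sigma> :: "'a \<Rightarrow> 'r::comm_ring_1"
  assumes inj: "inj_on \<sigma> (carrier R)"
    and closed: "\<And>x y. x \<in> carrier R \<Longrightarrow> y \<in> carrier R \<Longrightarrow> x \<otimes> y \<in> carrier R"
      "\<And>x y. x \<in> carrier R \<Longrightarrow> y \<in> carrier R \<Longrightarrow> x \<oplus> y \<in> carrier R"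
      "\<one> \<in> carrier R" "\<zero> \<in> carrier R" "\<And>x. x \<in> carrier R \<Longrightarrow> \<exists>y\<in>carrier R. \<sigma> y = - \<sigma> x"
    and hom: "\<And>x y. x \<in> carrier R \<Longrightarrow> y \<in> carrier R \<Longrightarrow> \<sigma> (x \<otimes> y) = \<sigma> x * \<sigma> y"
      "\<And>x y. x \<in> carrier R \<Longrightarrow> y \<in> carrier R \<Longrightarrow> \<sigma> (x \<oplus> y) = \<sigma> x + \<sigma> y"
      "\<sigma> \<one> = 1" "\<sigma> \<zero> = 0"
  shows "cring R"
proof -
  have eqI: "x = y" if "\<sigma> x = \<sigma> y" "x \<in> carrier R" "y \<in> carrier R" for x y
    using inj that by (auto dest: inj_onD)
  show ?thesis
  proof (rule cringI)
    show "abelian_group R"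
    proof (rule abelian_groupI)
      show "\<exists>y\<in>carrier R. y \<oplus> x = \<zero>" if x: "x \<in> carrier R" for x
      proof -
        obtain y where y: "y \<in> carrier R" "\<sigma> y = - \<sigma> x" using closed(5)[OF x] by blast
        have "y \<oplus> x = \<zero>" by (rule eqI) (simp_all add: hom closed x y)
        then show ?thesis using y(1) by blast
      qed
    qed (auto intro!: eqI simp: closed hom algebra_simps)
    show "comm_monoid R"
      by (rule comm_monoidI) (auto intro!: eqI simp: closed hom algebra_simps)
  qed (auto intro!: eqI simp: closed hom algebra_simps)
qed

text \<open>
  A graded ring presented as the subring of \<open>R[T]\<close> that consists of all polynomials whose coefficient
  at \<open>T\<^sup>d\<close> lies in \<open>V d\<close>; the exponent of \<open>T\<close> is the degree, so that a homogeneous element of degree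
  \<open>d\<close> is a monomial \<open>p T\<^sup>d\<close> with \<open>p\<close> in \<open>V d\<close>.
\<close>

locale graded_embedding =
  fixes S :: "('a, 'k) graded_algebra" (structure)
    and \<sigma> :: "'a \<Rightarrow> 'r::idom poly" and V :: "nat \<Rightarrow> 'r set"
  assumes cring: "cring S"
    and \<sigma>_mult: "\<And>x y. x \<in> carrier S \<Longrightarrow> y \<in> carrier S \<Longrightarrow> \<sigma> (x \<otimes> y) = \<sigma> x * \<sigma> y"
    and \<sigma>_add: "\<And>x y. x \<in> carrier S \<Longrightarrow> y \<in> carrier S \<Longrightarrow> \<sigma> (x \<oplus> y) = \<sigma> x + \<sigma> y"
    and \<sigma>_one: "\<sigma> \<one> = 1"
    and \<sigma>_inj: "inj_on \<sigma> (carrier S)"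
    and \<sigma>_image: "\<sigma> ` carrier S = {F. \<forall>d. coeff F d \<in> V d}"
    and \<sigma>_grade: "grade S d = {x \<in> carrier S. \<exists>p. \<sigma> x = monom p d}"
begin

interpretation cring S by (rule cring)

lemma \<sigma>_zero: "\<sigma> \<zero> = 0"
proof -
  have "\<sigma> \<zero> + \<sigma> \<zero> = \<sigma> \<zero> + 0" using \<sigma>_add[of \<zero> \<zero>] by (simp only: l_zero zero_closed add_0_right)
  then show ?thesis by (rule add_left_imp_eq)
qed

lemma \<sigma>_eqI: "\<sigma> x = \<sigma> y \<Longrightarrow> x \<in> carrier S \<Longrightarrow> y \<in> carrier S \<Longrightarrow> x = y"
  using \<sigma>_inj by (auto dest: inj_onD)

lemma \<sigma>_coeff: "x \<in> carrier S \<Longrightarrow> coeff (\<sigma> x) d \<in> V d"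
  using \<sigma>_image by auto

lemma zero_coeff: "0 \<in> V d"
  using \<sigma>_coeff[of \<zero> d] by (simp add: \<sigma>_zero)

lemma \<sigma>_surj:
  assumes "\<And>d. coeff F d \<in> V d"
  obtains x where "x \<in> carrier S" "\<sigma> x = F"
proof -
  have "F \<in> \<sigma> ` carrier S" using assms by (simp add: \<sigma>_image)
  then show thesis using that by blast
qed

lemma homogeneousE:
  assumes "p \<in> V d"
  obtains x where "x \<in> grade S d" "\<sigma> x = monom p d"
proof -
  obtain x where "x \<in> carrier S" "\<sigma> x = monom p d"
    by (rule \<sigma>_surj[of "monom p d"]) (auto simp: assms zero_coeff)
  then show thesis using that by (auto simp: \<sigma>_grade)
qed

lemma homogeneousD:
  assumes "x \<in> grade S d"
  obtains p where "p \<in> V d" "\<sigma> x = monom p d" "x \<in> carrier S"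
proof -
  obtain p where "x \<in> carrier S" "\<sigma> x = monom p d" using assms by (auto simp: \<sigma>_grade)
  then show thesis using that \<sigma>_coeff[of x d] by simp
qed

definition component :: "nat \<Rightarrow> 'a \<Rightarrow> 'a" where
  "component d x = inv_into (carrier S) \<sigma> (monom (coeff (\<sigma> x) d) d)"

lemma component:
  assumes "x \<in> carrier S"
  shows "component d x \<in> carrier S" "\<sigma> (component d x) = monom (coeff (\<sigma> x) d) d"
proof -
  obtain y where "y \<in> grade S d" "\<sigma> y = monom (coeff (\<sigma> x) d) d"
    using homogeneousE[OF \<sigma>_coeff[OF assms]] .
  then have "monom (coeff (\<sigma> x) d) d \<in> \<sigma> ` carrier S" by (metis \<open>y \<in> grade S d\<close> homogeneousD imageI)
  then show "component d x \<in> carrier S" "\<sigma> (component d x) = monom (coeff (\<sigma> x) d) d"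
    unfolding component_def by (auto intro: inv_into_into f_inv_into_f)
qed

lemma \<sigma>_finsum:
  assumes "finite D" "f \<in> D \<rightarrow> carrier S"
  shows "\<sigma> (\<Oplus>d\<in>D. f d) = (\<Sum>d\<in>D. \<sigma> (f d))"
  using assms by (induction D rule: finite_induct) (auto simp: \<sigma>_zero \<sigma>_add)

sublocale graded_domain S component
proof
  show "\<one> \<noteq> \<zero>" using \<sigma>_zero \<sigma>_one by auto
  show "a = \<zero> \<or> b = \<zero>" if "a \<otimes> b = \<zero>" "a \<in> carrier S" "b \<in> carrier S" for a b
  proof -
    have "\<sigma> a * \<sigma> b = 0" using that \<sigma>_mult[of a b] by (simp add: \<sigma>_zero)
    then show ?thesis using that \<sigma>_eqI[of a \<zero>] \<sigma>_eqI[of b \<zero>] by (auto simp: \<sigma>_zero)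
  qed
  show "x \<in> carrier S" if "x \<in> grade S d" for x d using that by (simp add: \<sigma>_grade)
  show "\<one> \<in> grade S 0" by (auto simp: \<sigma>_grade \<sigma>_one intro!: exI[of _ 1])
  show "a \<otimes> b \<in> grade S (d + e)" if "a \<in> grade S d" "b \<in> grade S e" for a b d e
    using that by (auto simp: \<sigma>_grade \<sigma>_mult mult_monom)
  show "a \<oplus> b \<in> grade S d" if "a \<in> grade S d" "b \<in> grade S d" for a b d
    using that by (auto simp: \<sigma>_grade \<sigma>_add add_monom)
  show "component d x \<in> grade S d" if "x \<in> carrier S" for x d
    using component[OF that] by (auto simp: \<sigma>_grade)
  show "component d x = (if d = e then x else \<zero>)" if "x \<in> grade S e" for x d e
    using that component[of x d] by (intro \<sigma>_eqI) (auto simp: \<sigma>_grade \<sigma>_zero)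
  show "component d (x \<oplus> y) = component d x \<oplus> component d y"
    if "x \<in> carrier S" "y \<in> carrier S" for x y d
    by (rule \<sigma>_eqI) (simp_all add: component \<sigma>_add that add_monom)
  show "component d (a \<otimes> x) = (if e \<le> d then a \<otimes> component (d - e) x else \<zero>)"
    if a: "a \<in> grade S e" and x: "x \<in> carrier S" for a x e d
  proof (rule \<sigma>_eqI)
    obtain p where p: "\<sigma> a = monom p e" "a \<in> carrier S" using homogeneousD[OF a] by metis
    show "component d (a \<otimes> x) \<in> carrier S" using x p component by simp
    show "(if e \<le> d then a \<otimes> component (d - e) x else \<zero>) \<in> carrier S"
      using x p component by simp
    show "\<sigma> (component d (a \<otimes> x)) = \<sigma> (if e \<le> d then a \<otimes> component (d - e) x else \<zero>)"
      using x p by (simp add: component \<sigma>_mult \<sigma>_zero mult_monom coeff_monom_mult)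
  qed
  show "\<exists>n. x = (\<Oplus>d\<in>{..n}. component d x)" if x: "x \<in> carrier S" for x
  proof (intro exI \<sigma>_eqI x)
    have f: "(\<lambda>d. component d x) \<in> {..degree (\<sigma> x)} \<rightarrow> carrier S" using component x by auto
    show "(\<Oplus>d\<in>{..degree (\<sigma> x)}. component d x) \<in> carrier S" using f by (rule finsum_closed)
    show "\<sigma> x = \<sigma> (\<Oplus>d\<in>{..degree (\<sigma> x)}. component d x)"
      using f by (simp add: \<sigma>_finsum component x poly_as_sum_of_monoms)
  qed
qed

end

text \<open>
  Graded subrings of the same polynomial ring are compared there: an element of \<open>S\<close> is sent to the
  element of \<open>T\<close> that represents the same polynomial.
\<close>

lemma graded_extension_of_embeddings:
  fixes S :: "('a, 'k) graded_algebra" and T :: "('b, 'k) graded_algebra"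
    and \<sigma> :: "'a \<Rightarrow> 'r::idom poly" and \<tau> :: "'b \<Rightarrow> 'r poly"
  assumes "graded_embedding S \<sigma> V" "graded_embedding T \<tau> W"
    and sub: "\<And>d. V d \<subseteq> W d"
    and scalar: "\<And>c. scalar S c \<in> grade S 0" "\<And>c. scalar T c \<in> carrier T"
      "\<And>c. \<sigma> (scalar S c) = \<tau> (scalar T c)"
  defines "\<iota> \<equiv> \<lambda>x. inv_into (carrier T) \<tau> (\<sigma> x)"
  shows "graded_extension S (graded_embedding.component S \<sigma>) T (graded_embedding.component T \<tau>) \<iota>"
    and "\<And>x. x \<in> carrier S \<Longrightarrow> \<iota> x \<in> carrier T \<and> \<tau> (\<iota> x) = \<sigma> x"
proof -
  interpret S: graded_embedding S \<sigma> V by fact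
  interpret T: graded_embedding T \<tau> W by fact
  have \<iota>: "\<iota> x \<in> carrier T" "\<tau> (\<iota> x) = \<sigma> x" if "x \<in> carrier S" for x
  proof -
    have "\<sigma> x \<in> \<tau> ` carrier T" using S.\<sigma>_coeff[OF that] sub unfolding T.\<sigma>_image by blast
    then show "\<iota> x \<in> carrier T" "\<tau> (\<iota> x) = \<sigma> x"
      unfolding \<iota>_def by (auto intro: inv_into_into f_inv_into_f)
  qed
  then show "\<And>x. x \<in> carrier S \<Longrightarrow> \<iota> x \<in> carrier T \<and> \<tau> (\<iota> x) = \<sigma> x" by blast
  show "graded_extension S S.component T T.component \<iota>"
  proof
    show "\<iota> \<in> ring_hom S T"
      by (rule ring_hom_memI)
        (auto intro!: T.\<sigma>_eqI simp: \<iota> S.\<sigma>_add T.\<sigma>_add S.\<sigma>_mult T.\<sigma>_mult S.\<sigma>_one T.\<sigma>_one)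
    show "inj_on \<iota> (carrier S)"
      by (rule inj_onI) (metis S.\<sigma>_eqI \<iota>(2))
    show "\<iota> a \<in> grade T d \<longleftrightarrow> a \<in> grade S d" if "a \<in> carrier S" for a d
      using that by (simp add: S.\<sigma>_grade T.\<sigma>_grade \<iota>)
    show "\<iota> (S.component d a) = T.component d (\<iota> a)" if "a \<in> carrier S" for a d
      using that by (intro T.\<sigma>_eqI) (simp_all add: \<iota> S.component T.component)
    show "scalar S c \<in> grade S 0" for c by (rule scalar)
    show "\<iota> (scalar S c) = scalar T c" for c
      using S.grade_carrier[OF scalar(1)] by (intro T.\<sigma>_eqI) (simp_all add: \<iota> scalar)
  qed
qed

section \<open>The cuspidal cubic and the twisted cubic as embedded varieties\<close>

text \<open>
  The exponents of \<open>u\<close> in the images \<open>T, u\<^sup>2T, u\<^sup>3T, uT\<close> of \<open>x\<^sub>0, \<dots>, x\<^sub>3\<close>. In this order the first three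
  variables parametrise the cuspidal cubic, so that the same substitution, restricted to \<open>N = 2\<close> or
  \<open>N = 3\<close>, serves both curves.
\<close>

definition variable_weight :: "nat \<Rightarrow> nat" where
  "variable_weight i = (if i = 1 then 2 else if i = 2 then 3 else if i = 3 then 1 else 0)"

definition weight :: "(nat \<Rightarrow>\<^sub>0 nat) \<Rightarrow> nat" where
  "weight m = (\<Sum>i\<in>Poly_Mapping.keys m. variable_weight i * Poly_Mapping.lookup m i)"

lemma monom_degree_superset:
  "finite A \<Longrightarrow> Poly_Mapping.keys m \<subseteq> A \<Longrightarrow> monom_degree m = (\<Sum>i\<in>A. Poly_Mapping.lookup m i)"
  unfolding monom_degree_def by (rule sum.mono_neutral_left) (auto simp: in_keys_iff)

lemma weight_superset:
  "finite A \<Longrightarrow> Poly_Mapping.keys m \<subseteq> A \<Longrightarrow>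
    weight m = (\<Sum>i\<in>A. variable_weight i * Poly_Mapping.lookup m i)"
  unfolding weight_def by (rule sum.mono_neutral_left) (auto simp: in_keys_iff)

lemma monom_degree_add: "monom_degree (m + n) = monom_degree m + monom_degree n"
proof -
  let ?A = "Poly_Mapping.keys m \<union> Poly_Mapping.keys n"
  have "Poly_Mapping.keys (m + n) \<subseteq> ?A" by (rule Poly_Mapping.keys_add)
  then show ?thesis
    by (simp add: monom_degree_superset[of ?A] lookup_add sum.distrib)
qed

lemma weight_add: "weight (m + n) = weight m + weight n"
proof -
  let ?A = "Poly_Mapping.keys m \<union> Poly_Mapping.keys n"
  have "Poly_Mapping.keys (m + n) \<subseteq> ?A" by (rule Poly_Mapping.keys_add)
  then show ?thesis
    by (simp add: weight_superset[of ?A] lookup_add sum.distrib algebra_simps)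
qed

lemma monom_degree_zero [simp]: "monom_degree 0 = 0" and weight_zero [simp]: "weight 0 = 0"
  by (simp_all add: monom_degree_def weight_def)

lemma monom_degree_single [simp]: "monom_degree (Poly_Mapping.single i n) = n"
  and weight_single [simp]: "weight (Poly_Mapping.single i n) = variable_weight i * n"
  by (simp_all add: monom_degree_def weight_def)

text \<open>
  The substitution \<open>x\<^sub>i \<mapsto> u\<^sup>w T\<close> with \<open>w\<close> the weight of \<open>x\<^sub>i\<close>: a monomial of degree \<open>d\<close> and weight \<open>j\<close> is
  mapped to \<open>u\<^sup>j T\<^sup>d\<close>.
\<close>

definition curve_param :: "'k::field mpoly \<Rightarrow> 'k poly poly" where
  "curve_param p = (\<Sum>m\<in>Poly_Mapping.keys p.
     monom (monom (Poly_Mapping.lookup p m) (weight m)) (monom_degree m))"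

lemma curve_param_superset:
  "finite A \<Longrightarrow> Poly_Mapping.keys p \<subseteq> A \<Longrightarrow> curve_param p =
    (\<Sum>m\<in>A. monom (monom (Poly_Mapping.lookup p m) (weight m)) (monom_degree m))"
  unfolding curve_param_def by (rule sum.mono_neutral_left) (auto simp: in_keys_iff)

lemma curve_param_add: "curve_param (p + q) = curve_param p + curve_param q"
proof -
  let ?A = "Poly_Mapping.keys p \<union> Poly_Mapping.keys q"
  have "Poly_Mapping.keys (p + q) \<subseteq> ?A" by (rule Poly_Mapping.keys_add)
  then show ?thesis
    by (simp add: curve_param_superset[of ?A] lookup_add sum.distrib flip: add_monom)
qed

lemma curve_param_zero [simp]: "curve_param 0 = 0"
  by (simp add: curve_param_def)

lemma curve_param_uminus: "curve_param (- p) = - curve_param p"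
  using curve_param_add[of p "- p"] by (simp add: eq_neg_iff_add_eq_0 add.commute)

lemma curve_param_sum: "curve_param (\<Sum>i\<in>A. f i) = (\<Sum>i\<in>A. curve_param (f i))"
  by (induction A rule: infinite_finite_induct) (simp_all add: curve_param_add)

lemma curve_param_single [simp]:
  "curve_param (Poly_Mapping.single m c) = monom (monom c (weight m)) (monom_degree m)"
  by (simp add: curve_param_def)

lemma mpoly_sum_single:
  "(\<Sum>m\<in>Poly_Mapping.keys p. Poly_Mapping.single m (Poly_Mapping.lookup p m)) = p"
proof (rule poly_mapping_eqI)
  fix k
  have "(\<Sum>m\<in>Poly_Mapping.keys p. (Poly_Mapping.lookup p m when m = k)) =
    (\<Sum>m\<in>Poly_Mapping.keys p. if m = k then Poly_Mapping.lookup p m else 0)"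
    by (simp add: when_def)
  then show "Poly_Mapping.lookup (\<Sum>m\<in>Poly_Mapping.keys p.
      Poly_Mapping.single m (Poly_Mapping.lookup p m)) k = Poly_Mapping.lookup p k"
    by (simp add: lookup_sum lookup_single in_keys_iff)
qed

lemma curve_param_mult: "curve_param (p * q) = curve_param p * curve_param q"
proof -
  let ?s = "\<lambda>p. \<Sum>m\<in>Poly_Mapping.keys p. Poly_Mapping.single m (Poly_Mapping.lookup p m)"
  have "curve_param (p * q) = curve_param (?s p * ?s q)" by (simp only: mpoly_sum_single)
  also have "\<dots> = (\<Sum>m\<in>Poly_Mapping.keys p. \<Sum>n\<in>Poly_Mapping.keys q.
      monom (monom (Poly_Mapping.lookup p m) (weight m)) (monom_degree m) *
      monom (monom (Poly_Mapping.lookup q n) (weight n)) (monom_degree n))"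
    by (simp add: sum_product curve_param_sum mult_single mult_monom weight_add monom_degree_add)
  also have "\<dots> = curve_param p * curve_param q"
    by (simp add: sum_product curve_param_def)
  finally show ?thesis .
qed

lemma curve_param_one [simp]: "curve_param 1 = 1"
  using curve_param_single[of 0 1] by (simp del: curve_param_single)

lemma polynomials_add: "p \<in> polynomials N \<Longrightarrow> q \<in> polynomials N \<Longrightarrow> p + q \<in> polynomials N"
  using Poly_Mapping.keys_add[of p q] by (auto simp: polynomials_def)

lemma polynomials_zero: "0 \<in> polynomials N"
  by (simp add: polynomials_def)

lemma polynomials_single: "Poly_Mapping.keys m \<subseteq> {..N} \<Longrightarrow> Poly_Mapping.single m c \<in> polynomials N"
  by (simp add: polynomials_def)

lemma polynomials_sum: "(\<And>i. i \<in> A \<Longrightarrow> f i \<in> polynomials N) \<Longrightarrow> (\<Sum>i\<in>A. f i) \<in> polynomials N"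
  by (induction A rule: infinite_finite_induct) (auto simp: polynomials_zero polynomials_add)

lemma polynomials_uminus: "p \<in> polynomials N \<Longrightarrow> - p \<in> (polynomials N :: 'k::field mpoly set)"
  by (simp add: polynomials_def in_keys_iff)

lemma polynomials_mult:
  assumes "p \<in> polynomials N" "q \<in> polynomials N"
  shows "p * q \<in> (polynomials N :: 'k::field mpoly set)"
  unfolding polynomials_def
proof (intro CollectI ballI)
  fix m assume "m \<in> Poly_Mapping.keys (p * q)"
  then obtain a b where "m = a + b" "a \<in> Poly_Mapping.keys p" "b \<in> Poly_Mapping.keys q"
    using Poly_Mapping.keys_mult[of p q] by blast
  then show "Poly_Mapping.keys m \<subseteq> {..N}"
    using assms Poly_Mapping.keys_add[of a b] unfolding polynomials_def by blast
qed

lemma polynomials_one: "1 \<in> (polynomials N :: 'k::field mpoly set)"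
  by (simp add: polynomials_def)

lemma cring_poly_algebra: "cring (poly_algebra N :: ('k::field mpoly, 'k) graded_algebra)"
  by (rule cring_of_embedding[of id])
    (auto simp: poly_algebra_def polynomials_mult polynomials_add polynomials_one polynomials_zero
      intro: polynomials_uminus)

definition homogeneous_part :: "nat \<Rightarrow> 'k::field mpoly \<Rightarrow> 'k mpoly" where
  "homogeneous_part d p = (\<Sum>m\<in>{m\<in>Poly_Mapping.keys p. monom_degree m = d}.
     Poly_Mapping.single m (Poly_Mapping.lookup p m))"

lemma homogeneous_part_grade:
  assumes "p \<in> polynomials N"
  shows "homogeneous_part d p \<in> grade (poly_algebra N) d"
proof -
  have "Poly_Mapping.keys (homogeneous_part d p) \<subseteq> {m\<in>Poly_Mapping.keys p. monom_degree m = d}"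
    by (auto simp: in_keys_iff homogeneous_part_def lookup_sum lookup_single when_def
        split: if_splits elim!: sum.not_neutral_contains_not_neutral)
  then show ?thesis using assms by (auto simp: poly_algebra_def polynomials_def)
qed

lemma curve_param_homogeneous_part:
  "curve_param (homogeneous_part d p) = monom (coeff (curve_param p) d) d"
proof -
  have "curve_param (homogeneous_part d p) = (\<Sum>m\<in>Poly_Mapping.keys p.
      if monom_degree m = d then monom (monom (Poly_Mapping.lookup p m) (weight m)) d else 0)"
    unfolding homogeneous_part_def curve_param_sum by (subst sum.inter_filter) (auto intro: sum.cong)
  also have "\<dots> = (\<Sum>m\<in>Poly_Mapping.keys p.
      monom (coeff (monom (monom (Poly_Mapping.lookup p m) (weight m)) (monom_degree m)) d) d)"
    by (rule sum.cong) auto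
  also have "\<dots> = monom (coeff (curve_param p) d) d"
    by (simp add: curve_param_def coeff_sum monom_sum)
  finally show ?thesis .
qed

lemma sum_homogeneous_part:
  "(\<Sum>d\<in>monom_degree ` Poly_Mapping.keys p. homogeneous_part d p) = p"
proof -
  have "(\<Sum>d\<in>monom_degree ` Poly_Mapping.keys p. homogeneous_part d p) =
     (\<Sum>m\<in>Poly_Mapping.keys p. Poly_Mapping.single m (Poly_Mapping.lookup p m))"
    unfolding homogeneous_part_def by (rule sum.image_gen[symmetric]) simp
  then show ?thesis by (simp add: mpoly_sum_single)
qed

definition curve_ideal :: "nat \<Rightarrow> 'k::field mpoly set" where
  "curve_ideal N = {p \<in> polynomials N. curve_param p = 0}"

lemma poly_algebra_simps [simp]:
  "carrier (poly_algebra N) = polynomials N"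
  "x \<otimes>\<^bsub>poly_algebra N\<^esub> y = x * y" "x \<oplus>\<^bsub>poly_algebra N\<^esub> y = x + y"
  "\<one>\<^bsub>poly_algebra N\<^esub> = 1" "\<zero>\<^bsub>poly_algebra N\<^esub> = 0"
  "scalar (poly_algebra N) c = Poly_Mapping.single 0 c"
  by (simp_all add: poly_algebra_def)

lemma curve_ideal_ideal: "ideal (curve_ideal N :: 'k::field mpoly set) (poly_algebra N)"
proof (rule idealI)
  interpret cring "poly_algebra N :: ('k::field mpoly, 'k) graded_algebra" by (rule cring_poly_algebra)
  show "ring (poly_algebra N :: ('k::field mpoly, 'k) graded_algebra)" by (rule ring_axioms)
  show "subgroup (curve_ideal N :: 'k mpoly set) (add_monoid (poly_algebra N))"
  proof (rule add.subgroupI)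
    show "\<ominus>\<^bsub>poly_algebra N\<^esub> a \<in> curve_ideal N" if "a \<in> curve_ideal N" for a :: "'k mpoly"
    proof -
      have "a \<in> polynomials N" using that by (simp add: curve_ideal_def)
      then have "\<ominus>\<^bsub>poly_algebra N\<^esub> a = - a"
        by (intro minus_equality) (simp_all add: polynomials_uminus)
      then show ?thesis using that by (simp add: curve_ideal_def polynomials_uminus curve_param_uminus)
    qed
    have "0 \<in> (curve_ideal N :: 'k mpoly set)" by (simp add: curve_ideal_def polynomials_zero)
    then show "(curve_ideal N :: 'k mpoly set) \<noteq> {}" by blast
  qed (auto simp: curve_ideal_def polynomials_add curve_param_add)
qed (auto simp: curve_ideal_def polynomials_mult curve_param_mult)

lemma curve_ideal_prime: "primeideal (curve_ideal N :: 'a::field mpoly set) (poly_algebra N)"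
proof (rule primeidealI[OF curve_ideal_ideal cring_poly_algebra])
  show "carrier (poly_algebra N) \<noteq> (curve_ideal N :: 'a mpoly set)"
  proof -
    have "(1 :: 'a mpoly) \<in> polynomials N" "(1 :: 'a mpoly) \<notin> curve_ideal N"
      by (simp_all add: polynomials_one curve_ideal_def)
    then show ?thesis unfolding poly_algebra_simps by blast
  qed
qed (auto simp: curve_ideal_def curve_param_mult)

text \<open>
  The substitution turns the degree into the exponent of \<open>T\<close>. So if \<open>p\<close> is mapped to zero, then so
  are its homogeneous parts.
\<close>

lemma curve_ideal_homogeneous:
  "homogeneous_ideal (curve_ideal N :: 'k::field mpoly set) (poly_algebra N)"
proof -
  let ?R = "poly_algebra N :: ('k::field mpoly, 'k) graded_algebra"
  let ?H = "curve_ideal N \<inter> (\<Union>d. grade ?R d)"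
  interpret cring ?R by (rule cring_poly_algebra)
  have sub: "?H \<subseteq> carrier ?R" by (auto simp: curve_ideal_def)
  interpret J: ideal "Idl\<^bsub>?R\<^esub> ?H" ?R by (rule genideal_ideal[OF sub])
  have "Idl\<^bsub>?R\<^esub> ?H \<subseteq> curve_ideal N" by (rule genideal_minimal[OF curve_ideal_ideal]) auto
  moreover have "p \<in> Idl\<^bsub>?R\<^esub> ?H" if p: "p \<in> curve_ideal N" for p :: "'k mpoly"
  proof -
    have part: "homogeneous_part d p \<in> Idl\<^bsub>?R\<^esub> ?H" for d
    proof -
      have "homogeneous_part d p \<in> grade ?R d"
        using p by (intro homogeneous_part_grade) (simp add: curve_ideal_def)
      moreover from this have "homogeneous_part d p \<in> curve_ideal N"
        using p by (simp add: curve_ideal_def curve_param_homogeneous_part poly_algebra_def)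
      ultimately show ?thesis using genideal_self[OF sub] by blast
    qed
    have "(\<Sum>d\<in>D. homogeneous_part d p) \<in> Idl\<^bsub>?R\<^esub> ?H" if "finite D" for D
      using that
    proof (induction D rule: finite_induct)
      case empty
      then show ?case using J.zero_closed by simp
    next
      case (insert d D)
      then show ?case using J.a_closed[OF part[of d] insert.IH] by simp
    qed
    from this[of "monom_degree ` Poly_Mapping.keys p"] show ?thesis by (simp add: sum_homogeneous_part)
  qed
  ultimately show ?thesis unfolding homogeneous_ideal_def using curve_ideal_ideal by blast
qed

lemma curve_ideal_variety: "projective_variety N (curve_ideal N :: 'k::field mpoly set)"
proof -
  let ?x = "Poly_Mapping.single (Poly_Mapping.single 0 1) 1 :: 'k mpoly"
  interpret cring "poly_algebra N :: ('k mpoly, 'k) graded_algebra" by (rule cring_poly_algebra)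
  have "?x \<in> grade (poly_algebra N) 1" by (simp add: poly_algebra_def polynomials_single)
  moreover have "(\<Union>d\<in>{0<..}. grade (poly_algebra N :: ('k mpoly, 'k) graded_algebra) d) \<subseteq>
      carrier (poly_algebra N)"
    by (auto simp: poly_algebra_def)
  ultimately have "?x \<in> irrelevant_ideal (poly_algebra N)"
    unfolding irrelevant_ideal_def using genideal_self by (metis (no_types, lifting) UN_I greaterThan_iff less_one subsetD zero_less_one)
  moreover have "?x \<notin> curve_ideal N" by (simp add: curve_ideal_def)
  ultimately show ?thesis
    using curve_ideal_prime curve_ideal_homogeneous by (auto simp: projective_variety_def)
qed

section \<open>Their homogeneous coordinate rings\<close>

lemma coordinate_algebra_simps:
  "carrier (coordinate_algebra N I) = a_rcosets\<^bsub>poly_algebra N\<^esub> I"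
  "A \<otimes>\<^bsub>coordinate_algebra N I\<^esub> B = rcoset_mult (poly_algebra N) I A B"
  "\<one>\<^bsub>coordinate_algebra N I\<^esub> = I +>\<^bsub>poly_algebra N\<^esub> \<one>\<^bsub>poly_algebra N\<^esub>"
  "\<zero>\<^bsub>coordinate_algebra N I\<^esub> = I"
  "A \<oplus>\<^bsub>coordinate_algebra N I\<^esub> B = A <+>\<^bsub>poly_algebra N\<^esub> B"
  "grade (coordinate_algebra N I) d = (\<lambda>p. I +>\<^bsub>poly_algebra N\<^esub> p) ` grade (poly_algebra N) d"
  "scalar (coordinate_algebra N I) c = I +>\<^bsub>poly_algebra N\<^esub> scalar (poly_algebra N) c"
  by (simp_all add: coordinate_algebra_def ring.extend_def graded_algebra.fields_def FactRing_def)

abbreviation curve_algebra :: "nat \<Rightarrow> ('k::field mpoly set, 'k) graded_algebra" where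
  "curve_algebra N \<equiv> coordinate_algebra N (curve_ideal N)"

definition param_class :: "nat \<Rightarrow> 'k::field mpoly \<Rightarrow> 'k mpoly set" where
  "param_class N p = {q \<in> polynomials N. curve_param q = curve_param p}"

text \<open>The cosets of a kernel are the fibres of the homomorphism.\<close>

lemma coset_eq_param_class:
  assumes "p \<in> polynomials N"
  shows "curve_ideal N +>\<^bsub>poly_algebra N\<^esub> p = param_class N p"
proof -
  have "q \<in> (\<lambda>h. h + p) ` curve_ideal N \<longleftrightarrow> q \<in> param_class N p" for q
  proof
    show "q \<in> param_class N p" if "q \<in> (\<lambda>h. h + p) ` curve_ideal N"
      using that assms by (auto simp: curve_ideal_def param_class_def polynomials_add curve_param_add)
    show "q \<in> (\<lambda>h. h + p) ` curve_ideal N" if q: "q \<in> param_class N p"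
    proof (rule image_eqI)
      show "q = (q - p) + p" by simp
      have "q + - p \<in> polynomials N" using q assms
        by (intro polynomials_add polynomials_uminus) (auto simp: param_class_def)
      then show "q - p \<in> curve_ideal N" using q curve_param_add[of q "- p"]
        by (simp add: curve_ideal_def param_class_def curve_param_uminus)
    qed
  qed
  then show ?thesis by (auto simp: a_r_coset_def r_coset_def poly_algebra_def)
qed

lemma grade_poly_algebra: "p \<in> grade (poly_algebra N) d \<longleftrightarrow>
    p \<in> polynomials N \<and> (\<forall>m\<in>Poly_Mapping.keys p. monom_degree m = d)"
  by (simp add: poly_algebra_def)

lemma curve_algebra_simps:
  "carrier (curve_algebra N) = param_class N ` polynomials N"
  "p \<in> polynomials N \<Longrightarrow> q \<in> polynomials N \<Longrightarrow>
    param_class N p \<otimes>\<^bsub>curve_algebra N\<^esub> param_class N q = param_class N (p * q)"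
  "p \<in> polynomials N \<Longrightarrow> q \<in> polynomials N \<Longrightarrow>
    param_class N p \<oplus>\<^bsub>curve_algebra N\<^esub> param_class N q = param_class N (p + q)"
  "\<one>\<^bsub>curve_algebra N\<^esub> = param_class N 1"
  "\<zero>\<^bsub>curve_algebra N\<^esub> = param_class N 0"
  "grade (curve_algebra N) d = param_class N ` grade (poly_algebra N) d"
  "scalar (curve_algebra N) c = param_class N (Poly_Mapping.single 0 c)"
proof -
  interpret I: ideal "curve_ideal N" "poly_algebra N" by (rule curve_ideal_ideal)
  show "carrier (curve_algebra N) = param_class N ` polynomials N"
    by (auto simp: coordinate_algebra_simps A_RCOSETS_def' coset_eq_param_class)
  show "param_class N p \<otimes>\<^bsub>curve_algebra N\<^esub> param_class N q = param_class N (p * q)"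
    if "p \<in> polynomials N" "q \<in> polynomials N"
    using I.rcoset_mult_add[of p q] that
    by (simp add: coordinate_algebra_simps coset_eq_param_class polynomials_mult)
  show "param_class N p \<oplus>\<^bsub>curve_algebra N\<^esub> param_class N q = param_class N (p + q)"
    if "p \<in> polynomials N" "q \<in> polynomials N"
    using I.a_rcos_sum[of p q] that
    by (simp add: coordinate_algebra_simps coset_eq_param_class polynomials_add)
  show "\<one>\<^bsub>curve_algebra N\<^esub> = param_class N 1"
    by (simp add: coordinate_algebra_simps coset_eq_param_class polynomials_one)
  show "\<zero>\<^bsub>curve_algebra N\<^esub> = param_class N 0"
    by (simp add: coordinate_algebra_simps param_class_def curve_ideal_def)
  show "grade (curve_algebra N) d = param_class N ` grade (poly_algebra N) d"
    unfolding coordinate_algebra_simps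
    by (rule image_cong) (simp_all add: coset_eq_param_class grade_poly_algebra)
  show "scalar (curve_algebra N) c = param_class N (Poly_Mapping.single 0 c)"
    by (simp add: coordinate_algebra_simps coset_eq_param_class polynomials_single)
qed

definition class_param :: "'k::field mpoly set \<Rightarrow> 'k poly poly" where
  "class_param C = curve_param (SOME p. p \<in> C)"

lemma class_param [simp]:
  assumes "p \<in> polynomials N"
  shows "class_param (param_class N p) = curve_param p"
proof -
  have "p \<in> param_class N p" using assms by (simp add: param_class_def)
  then have "(SOME q. q \<in> param_class N p) \<in> param_class N p" by (rule someI)
  then show ?thesis by (simp add: class_param_def param_class_def)
qed

definition weights :: "nat \<Rightarrow> nat \<Rightarrow> nat set" where
  "weights N d = {weight m | m. Poly_Mapping.keys m \<subseteq> {..N} \<and> monom_degree m = d}"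

definition forms :: "nat \<Rightarrow> nat \<Rightarrow> 'k::field poly set" where
  "forms N d = {p. \<forall>j. coeff p j \<noteq> 0 \<longrightarrow> j \<in> weights N d}"

lemma coeff_curve_param:
  "coeff (coeff (curve_param p) d) j =
    (\<Sum>m\<in>{m\<in>Poly_Mapping.keys p. monom_degree m = d \<and> weight m = j}. Poly_Mapping.lookup p m)"
proof -
  have "coeff (coeff (curve_param p) d) j = (\<Sum>m\<in>Poly_Mapping.keys p.
    if monom_degree m = d \<and> weight m = j then Poly_Mapping.lookup p m else 0)"
    unfolding curve_param_def coeff_sum by (rule sum.cong) auto
  then show ?thesis by (simp add: sum.inter_filter)
qed

text \<open>
  The image is spanned by the \<open>u\<^sup>j T\<^sup>d\<close> for which some monomial of degree \<open>d\<close> has weight \<open>j\<close>; a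
  preimage is found by choosing one such monomial for each pair \<open>(d, j)\<close>.
\<close>

lemma curve_param_image:
  "curve_param ` polynomials N = {F :: 'k::field poly poly. \<forall>d. coeff F d \<in> forms N d}"
proof (intro equalityI subsetI)
  fix F :: "'k poly poly" assume "F \<in> curve_param ` polynomials N"
  then obtain p where p: "p \<in> polynomials N" "F = curve_param p" by blast
  have "j \<in> weights N d" if nz: "coeff (coeff F d) j \<noteq> 0" for d j
  proof -
    obtain m where "m \<in> Poly_Mapping.keys p" "monom_degree m = d" "weight m = j"
      using nz unfolding p(2) coeff_curve_param
      by (auto elim!: sum.not_neutral_contains_not_neutral)
    then show ?thesis using p(1) by (auto simp: weights_def polynomials_def)
  qed
  then show "F \<in> {F. \<forall>d. coeff F d \<in> forms N d}" by (simp add: forms_def)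
next
  fix F :: "'k poly poly" assume "F \<in> {F. \<forall>d. coeff F d \<in> forms N d}"
  then have F: "j \<in> weights N d" if "coeff (coeff F d) j \<noteq> 0" for d j
    using that by (auto simp: forms_def)
  have "\<forall>d j. \<exists>m. coeff (coeff F d) j \<noteq> 0 \<longrightarrow>
      Poly_Mapping.keys m \<subseteq> {..N} \<and> monom_degree m = d \<and> weight m = j"
    using F by (auto simp: weights_def)
  then obtain mm where mm: "\<And>d j. coeff (coeff F d) j \<noteq> 0 \<Longrightarrow>
      Poly_Mapping.keys (mm d j) \<subseteq> {..N} \<and> monom_degree (mm d j) = d \<and> weight (mm d j) = j"
    by metis
  define p where "p = (\<Sum>d\<le>degree F. \<Sum>j\<le>degree (coeff F d).
    Poly_Mapping.single (mm d j) (coeff (coeff F d) j))"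
  have "Poly_Mapping.single (mm d j) (coeff (coeff F d) j) \<in> polynomials N" for d j
    using mm[of d j] by (cases "coeff (coeff F d) j = 0") (auto simp: polynomials_single polynomials_zero)
  then have "p \<in> polynomials N" unfolding p_def by (intro polynomials_sum)
  moreover have "curve_param p = F"
  proof -
    have "monom (monom (coeff (coeff F d) j) (weight (mm d j))) (monom_degree (mm d j)) =
      monom (monom (coeff (coeff F d) j) j) d" for d j
      using mm[of d j] by (cases "coeff (coeff F d) j = 0") auto
    then have "curve_param p = (\<Sum>d\<le>degree F. \<Sum>j\<le>degree (coeff F d). monom (monom (coeff (coeff F d) j) j) d)"
      unfolding p_def curve_param_sum curve_param_single by simp
    also have "\<dots> = (\<Sum>d\<le>degree F. monom (coeff F d) d)"
      by (simp add: monom_sum[symmetric] poly_as_sum_of_monoms)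
    also have "\<dots> = F" by (rule poly_as_sum_of_monoms)
    finally show ?thesis .
  qed
  ultimately show "F \<in> curve_param ` polynomials N" by blast
qed

text \<open>
  By the homomorphism theorem, the coordinate ring is the image of the substitution, a subring of
  \<open>k[u][T]\<close>.
\<close>

lemma curve_algebra_embedding:
  "graded_embedding (curve_algebra N :: ('k::field mpoly set, 'k) graded_algebra) class_param (forms N)"
proof (rule graded_embedding.intro)
  let ?S = "curve_algebra N :: ('k mpoly set, 'k) graded_algebra"
  have inj: "inj_on class_param (carrier ?S)"
  proof (rule inj_onI)
    fix x y assume xy: "x \<in> carrier ?S" "y \<in> carrier ?S" "class_param x = class_param y"
    then obtain p q where "p \<in> polynomials N" "x = param_class N p"
      "q \<in> polynomials N" "y = param_class N q" by (auto simp: curve_algebra_simps(1))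
    moreover from this have "curve_param p = curve_param q" using xy(3) by simp
    ultimately show "x = y" by (simp add: param_class_def)
  qed
  show "inj_on class_param (carrier ?S)" by (rule inj)
  show mult: "class_param (x \<otimes>\<^bsub>?S\<^esub> y) = class_param x * class_param y"
    if xy: "x \<in> carrier ?S" "y \<in> carrier ?S" for x y
  proof -
    obtain p q where "p \<in> polynomials N" "x = param_class N p"
      "q \<in> polynomials N" "y = param_class N q"
      using xy unfolding curve_algebra_simps(1) by blast
    then show ?thesis by (simp add: curve_algebra_simps(2) polynomials_mult curve_param_mult)
  qed
  show add: "class_param (x \<oplus>\<^bsub>?S\<^esub> y) = class_param x + class_param y"
    if xy: "x \<in> carrier ?S" "y \<in> carrier ?S" for x y
  proof -
    obtain p q where "p \<in> polynomials N" "x = param_class N p"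
      "q \<in> polynomials N" "y = param_class N q"
      using xy unfolding curve_algebra_simps(1) by blast
    then show ?thesis by (simp add: curve_algebra_simps(3) polynomials_add curve_param_add)
  qed
  show one: "class_param \<one>\<^bsub>?S\<^esub> = 1"
    by (simp add: curve_algebra_simps polynomials_one)
  show "cring ?S"
  proof (rule cring_of_embedding[of class_param])
    show "\<exists>y\<in>carrier ?S. class_param y = - class_param x" if x: "x \<in> carrier ?S" for x
    proof -
      obtain p where p: "p \<in> polynomials N" "x = param_class N p"
        using x by (auto simp: curve_algebra_simps(1))
      then have "param_class N (- p) \<in> carrier ?S" "class_param (param_class N (- p)) = - class_param x"
        by (auto simp: curve_algebra_simps(1) polynomials_uminus curve_param_uminus)
      then show ?thesis by blast
    qed
    show "x \<otimes>\<^bsub>?S\<^esub> y \<in> carrier ?S" "x \<oplus>\<^bsub>?S\<^esub> y \<in> carrier ?S"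
      if xy: "x \<in> carrier ?S" "y \<in> carrier ?S" for x y
    proof -
      obtain p q where "p \<in> polynomials N" "x = param_class N p"
      "q \<in> polynomials N" "y = param_class N q"
        using xy unfolding curve_algebra_simps(1) by blast
      then show "x \<otimes>\<^bsub>?S\<^esub> y \<in> carrier ?S" "x \<oplus>\<^bsub>?S\<^esub> y \<in> carrier ?S"
        by (simp_all add: curve_algebra_simps(1-3) polynomials_mult polynomials_add)
    qed
    show "\<one>\<^bsub>?S\<^esub> \<in> carrier ?S" "\<zero>\<^bsub>?S\<^esub> \<in> carrier ?S"
      by (simp_all add: curve_algebra_simps(1,4,5) polynomials_one polynomials_zero)
    show "class_param \<zero>\<^bsub>?S\<^esub> = 0" by (simp add: curve_algebra_simps(5) polynomials_zero)
  qed (fact inj mult add one)+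
  have "class_param ` carrier ?S = curve_param ` polynomials N"
    unfolding curve_algebra_simps(1) image_image by (rule image_cong) simp_all
  then show "class_param ` carrier ?S = {F. \<forall>d. coeff F d \<in> forms N d}"
    by (simp only: curve_param_image)
  show "grade ?S d = {x \<in> carrier ?S. \<exists>p. class_param x = monom p d}" for d
  proof (intro equalityI subsetI)
    fix x assume "x \<in> grade ?S d"
    then obtain p where p: "p \<in> grade (poly_algebra N) d" "x = param_class N p"
      by (auto simp: curve_algebra_simps)
    then have pN: "p \<in> polynomials N" and pd: "\<And>m. m \<in> Poly_Mapping.keys p \<Longrightarrow> monom_degree m = d"
      by (auto simp: poly_algebra_def)
    have "{m \<in> Poly_Mapping.keys p. monom_degree m = d} = Poly_Mapping.keys p" using pd by auto
    then have "homogeneous_part d p = p" by (simp add: homogeneous_part_def mpoly_sum_single)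
    then have "class_param x = monom (coeff (curve_param p) d) d"
      using pN by (metis class_param curve_param_homogeneous_part p(2))
    then show "x \<in> {x \<in> carrier ?S. \<exists>p. class_param x = monom p d}"
      using p(2) pN by (auto simp: curve_algebra_simps)
  next
    fix x assume "x \<in> {x \<in> carrier ?S. \<exists>p. class_param x = monom p d}"
    then obtain p q where p: "p \<in> polynomials N" "x = param_class N p" "curve_param p = monom q d"
      by (auto simp: curve_algebra_simps)
    have "curve_param (homogeneous_part d p) = curve_param p"
      unfolding curve_param_homogeneous_part p(3) by simp
    then have "x = param_class N (homogeneous_part d p)" by (simp add: p(2) param_class_def)
    then show "x \<in> grade ?S d"
      using homogeneous_part_grade[OF p(1)] by (auto simp: curve_algebra_simps)
  qed
qed

lemma curve_algebra_scalar:
  "scalar (curve_algebra N) c \<in> grade (curve_algebra N) 0"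
  "class_param (scalar (curve_algebra N) c) = [:[:c:]:]"
  by (auto simp: curve_algebra_simps polynomials_single poly_algebra_def monom_0)

text \<open>
  The weight of a monomial of degree \<open>d\<close> is a sum of \<open>d\<close> numbers from \<open>{0, 2, 3}\<close>, with \<open>1\<close> added to
  the set for the twisted cubic. All values up to \<open>3d\<close> are attained, except that \<open>1\<close> is not a sum
  of \<open>0\<close>, \<open>2\<close> and \<open>3\<close>: this gap is the cusp.
\<close>

lemma weights_3: "weights 3 d = {..3 * d}"
  and weights_2: "weights 2 d = {..3 * d} - {1}"
proof -
  have ub: "weight m \<le> 3 * monom_degree m" for m
    unfolding weight_def monom_degree_def sum_distrib_left
    by (rule sum_mono) (auto simp: variable_weight_def)
  have "weight m \<noteq> 1" if "Poly_Mapping.keys m \<subseteq> {..2}" for m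
  proof -
    have "{..2} = {0, 1, 2 :: nat}" by auto
    then have "weight m = 2 * Poly_Mapping.lookup m 1 + 3 * Poly_Mapping.lookup m 2"
      using weight_superset[OF _ that] by (simp add: variable_weight_def)
    then show ?thesis by presburger
  qed
  then have 1: "weights 2 d \<subseteq> {..3 * d} - {1}" using ub by (auto simp: weights_def)
  have 2: "weights 2 d \<subseteq> weights 3 d" by (force simp: weights_def)
  have 3: "weights 3 d \<subseteq> {..3 * d}" using ub by (auto simp: weights_def)
  let ?m = "\<lambda>a b c e. Poly_Mapping.single 0 a + Poly_Mapping.single 1 b +
    Poly_Mapping.single 2 c + Poly_Mapping.single 3 (e :: nat) :: nat \<Rightarrow>\<^sub>0 nat"
  have m: "monom_degree (?m a b c e) = a + b + c + e" "weight (?m a b c e) = 2 * b + 3 * c + e" for a b c e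
    by (simp_all add: monom_degree_add weight_add variable_weight_def)
  have keys: "Poly_Mapping.keys (?m a b c e) \<subseteq> {..3}" "Poly_Mapping.keys (?m a b c 0) \<subseteq> {..2}" for a b c e
    by (auto simp: in_keys_iff lookup_add lookup_single when_def split: if_splits)
  have 4: "j \<in> weights 2 d" if j: "j \<le> 3 * d" "j \<noteq> 1" for j
  proof -
    have "\<exists>a b c. a + b + c = d \<and> 2 * b + 3 * c = j"
    proof -
      define q where "q = j div 3"
      consider "j = 3 * q" | "j = 3 * q + 1" | "j = 3 * q + 2" unfolding q_def by linarith
      then show ?thesis
      proof cases
        case 1
        then have "(d - q) + 0 + q = d \<and> 2 * 0 + 3 * q = j" using j by simp
        then show ?thesis by blast
      next
        case 2
        then have "1 \<le> q" "q < d" using j by linarith+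
        then have "(d - q - 1) + 2 + (q - 1) = d \<and> 2 * 2 + 3 * (q - 1) = j" using 2 by arith
        then show ?thesis by blast
      next
        case 3
        then have "(d - q - 1) + 1 + q = d \<and> 2 * 1 + 3 * q = j" using j by simp
        then show ?thesis by blast
      qed
    qed
    then obtain a b c where "a + b + c = d" "2 * b + 3 * c = j" by blast
    then show ?thesis unfolding weights_def using keys(2)[of a b c] m[of a b c 0] by force
  qed
  have 5: "1 \<in> weights 3 d" if "1 \<le> 3 * d"
    unfolding weights_def using keys(1)[of "d - 1" 0 0 1] m[of "d - 1" 0 0 1] that by force
  show "weights 2 d = {..3 * d} - {1}" using 1 4 by auto
  show "weights 3 d = {..3 * d}" using 2 3 4 5 by (metis atMost_iff subsetD subsetI subset_antisym)
qed

section \<open>The cusp\<close>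

lemma forms_iff:
  assumes "N = 2 \<or> N = 3"
  shows "p \<in> forms N d \<longleftrightarrow> degree p \<le> 3 * d \<and> (N = 2 \<longrightarrow> coeff p 1 = 0)"
proof -
  have "(\<forall>j. coeff p j \<noteq> 0 \<longrightarrow> j \<le> 3 * d) \<longleftrightarrow> degree p \<le> 3 * d"
  proof
    assume "\<forall>j. coeff p j \<noteq> 0 \<longrightarrow> j \<le> 3 * d"
    then show "degree p \<le> 3 * d" by (intro degree_le) (meson not_le)
  next
    assume "degree p \<le> 3 * d"
    then show "\<forall>j. coeff p j \<noteq> 0 \<longrightarrow> j \<le> 3 * d" using le_degree order_trans by blast
  qed
  then show ?thesis
    using assms by (auto simp: forms_def weights_2 weights_3)
qed

text \<open>
  Coordinate rings of the cuspidal (\<open>N = 2\<close>) and the twisted (\<open>N = 3\<close>) cubic together, since the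
  analysis of the points with \<open>u\<^sup>3T = 0\<close> is the same for both.
\<close>

locale cuspidal_model = graded_embedding S \<sigma> "forms N"
  for S :: "('a, 'k::field) graded_algebra" (structure) and \<sigma> :: "'a \<Rightarrow> 'k poly poly" and N :: nat +
  assumes N: "N = 2 \<or> N = 3"
begin

lemmas forms = forms_iff[OF N]

lemma form_elementE:
  assumes "p \<in> forms N d"
  obtains x where "x \<in> grade S d" "x \<in> carrier S" "\<sigma> x = monom p d"
  using homogeneousE[OF assms] grade_carrier by metis

text \<open>The point \<open>u = 0\<close>. On the twisted cubic it is the point over the cusp.\<close>

definition cusp :: "'a set" where
  "cusp = {x \<in> carrier S. \<forall>d. coeff (coeff (\<sigma> x) d) 0 = 0}"

context
  fixes P :: "'a set" and y :: "'a"
  assumes P: "P \<in> proj_points S" and y: "y \<in> P" "\<sigma> y = monom (monom 1 3) 1"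
begin

text \<open>
  The element \<open>x = u q T\<^sup>d\<close> itself need not be a multiple of \<open>y = u\<^sup>3T\<close>, but its cube is: the cofactor
  has the coefficient \<open>q\<^sup>3\<close> in degree \<open>3d - 1\<close>. On the cuspidal cubic this cofactor is admissible, since
  \<open>u q\<close> has no linear term; hence \<open>u\<close> divides \<open>q\<close>, and \<open>q\<^sup>3\<close> has no linear term either.
\<close>

lemma multiple_in_point:
  assumes x: "x \<in> grade S d" "\<sigma> x = monom (pCons 0 q) d"
  shows "x \<in> P"
proof -
  note prime = proj_point_prime[OF P]
  have xc: "x \<in> carrier S" using x(1) grade_carrier by blast
  have yc: "y \<in> carrier S" using y(1) prime(3) by blast
  have p: "pCons 0 q \<in> forms N d" using \<sigma>_coeff[OF xc, of d] by (simp add: x(2))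
  show ?thesis
  proof (cases "q = 0")
    case True
    then have "x = \<zero>\<^bsub>S\<^esub>" using x(2) xc by (intro \<sigma>_eqI) (simp_all add: \<sigma>_zero)
    then show ?thesis using prime(2) additive_subgroup.zero_closed ideal.axioms(1) by blast
  next
    case False
    then have deg: "Suc (degree q) \<le> 3 * d" using p by (simp add: forms)
    then have d: "d \<ge> 1" by simp
    have "degree (q ^ 3) \<le> 3 * (3 * d - 1)"
      using degree_power_le[of q 3] deg by linarith
    moreover have "coeff (q ^ 3) 1 = 0" if "N = 2"
    proof -
      have "coeff (pCons 0 q) 1 = 0" using p that forms by blast
      then have "coeff q 0 = 0" by (simp add: coeff_pCons)
      then show ?thesis by (simp add: power3_eq_cube coeff_mult)
    qed
    ultimately have "q ^ 3 \<in> forms N (3 * d - 1)" by (simp add: forms)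
    then obtain z where z: "z \<in> carrier S" "\<sigma> z = monom (q ^ 3) (3 * d - 1)"
      by (rule form_elementE)
    have e: "(monom 1 3 :: 'k poly) * q ^ 3 = pCons 0 q * (pCons 0 q * pCons 0 q)"
      by (simp add: monom_altdef power3_eq_cube)
    have dd: "d + (d + d) = 3 * d" by simp
    have "x \<otimes>\<^bsub>S\<^esub> (x \<otimes>\<^bsub>S\<^esub> x) = y \<otimes>\<^bsub>S\<^esub> z"
      using xc yc z(1) d
      by (intro \<sigma>_eqI) (simp_all add: \<sigma>_mult x(2) y(2) z(2) mult_monom e dd del: mult_pCons_left mult_pCons_right)
    then have "x \<otimes>\<^bsub>S\<^esub> (x \<otimes>\<^bsub>S\<^esub> x) \<in> P" using prime(5)[OF yc z(1)] y(1) by simp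
    then show ?thesis using prime(5) xc by simp
  qed
qed

text \<open>
  Every form \<open>p T\<^sup>d\<close> differs from \<open>p(0) T\<^sup>d\<close> by an element of \<open>P\<close>, by the previous lemma. If \<open>P\<close>
  contained a power of \<open>T\<close>, and hence \<open>T\<close>, then it would contain all forms of positive degree.
\<close>

lemma monomial_notin_point:
  assumes "x \<in> carrier S" "\<sigma> x = monom 1 d"
  shows "x \<notin> P"
proof -
  note prime = proj_point_prime[OF P]
  interpret P: ideal P S by (rule prime(2))
  have "1 \<in> forms N 1" by (simp add: forms)
  then obtain t where t: "t \<in> grade S 1" "t \<in> carrier S" "\<sigma> t = monom 1 1"
    by (rule form_elementE)
  have "t \<notin> P"
  proof
    assume tP: "t \<in> P"
    have "h \<in> P" if d: "d > 0" and h: "h \<in> grade S d" for d h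
    proof -
      obtain p where p: "p \<in> forms N d" "\<sigma> h = monom p d" "h \<in> carrier S"
        using homogeneousD[OF h] .
      obtain c q where cq: "p = pCons c q" by (cases p)
      have "pCons 0 q \<in> forms N d" using p(1) by (auto simp: forms cq split: if_splits)
      then obtain h1 where h1: "h1 \<in> grade S d" "h1 \<in> carrier S" "\<sigma> h1 = monom (pCons 0 q) d"
        by (rule form_elementE)
      have "[:c:] \<in> forms N (d - 1)" by (simp add: forms)
      then obtain h2 where h2: "h2 \<in> carrier S" "\<sigma> h2 = monom [:c:] (d - 1)"
        by (rule form_elementE)
      have "h = h1 \<oplus>\<^bsub>S\<^esub> h2 \<otimes>\<^bsub>S\<^esub> t"
        using p(3) h1(2) h2(1) t(2) d
        by (intro \<sigma>_eqI) (simp_all add: \<sigma>_add \<sigma>_mult p(2) h1(3) h2(2) t(3) mult_monom add_monom cq)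
      moreover have "h2 \<otimes>\<^bsub>S\<^esub> t \<in> P" using tP h2(1) by (rule P.I_l_closed)
      ultimately show ?thesis using multiple_in_point[OF h1(1,3)] by simp
    qed
    then show False using P proj_points_iff by blast
  qed
  show ?thesis using assms
  proof (induction d arbitrary: x)
    case 0
    then have "x = \<one>\<^bsub>S\<^esub>" by (intro \<sigma>_eqI) (simp_all add: \<sigma>_one)
    then show ?case using prime(4) by simp
  next
    case (Suc d)
    have "1 \<in> forms N d" by (simp add: forms)
    then obtain z where z: "z \<in> carrier S" "\<sigma> z = monom 1 d" by (rule form_elementE)
    have "x = t \<otimes>\<^bsub>S\<^esub> z"
      using Suc.prems z(1) t(2) by (intro \<sigma>_eqI) (simp_all add: \<sigma>_mult z(2) t(3) mult_monom)
    then show ?case using prime(5)[OF t(2) z(1)] Suc.IH[OF z] \<open>t \<notin> P\<close> by simp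
  qed
qed

text \<open>
  Modulo \<open>P\<close> a form \<open>p T\<^sup>d\<close> equals \<open>p(0) T\<^sup>d\<close>, and by the previous lemma this is not in \<open>P\<close> unless
  \<open>p(0) = 0\<close>.
\<close>

lemma homogeneous_in_point_iff:
  assumes h: "h \<in> grade S d" "\<sigma> h = monom p d"
  shows "h \<in> P \<longleftrightarrow> coeff p 0 = 0"
proof -
  note prime = proj_point_prime[OF P]
  interpret P: ideal P S by (rule prime(2))
  have hc: "h \<in> carrier S" using h(1) grade_carrier by blast
  have p: "p \<in> forms N d" using \<sigma>_coeff[OF hc, of d] by (simp add: h(2))
  obtain c q where cq: "p = pCons c q" by (cases p)
  have "pCons 0 q \<in> forms N d" using p by (auto simp: forms cq split: if_splits)
  then obtain h1 where h1: "h1 \<in> grade S d" "h1 \<in> carrier S" "\<sigma> h1 = monom (pCons 0 q) d"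
    by (rule form_elementE)
  have h1P: "h1 \<in> P" by (rule multiple_in_point[OF h1(1,3)])
  show ?thesis
  proof
    show "h \<in> P" if "coeff p 0 = 0"
      using that h multiple_in_point[of h d q] by (simp add: cq)
    show "coeff p 0 = 0" if hP: "h \<in> P"
    proof (rule ccontr)
      assume "coeff p 0 \<noteq> 0"
      then have c: "c \<noteq> 0" by (simp add: cq)
      have "[:inverse c:] \<in> forms N 0" by (simp add: forms)
      then obtain z where z: "z \<in> carrier S" "\<sigma> z = monom [:inverse c:] 0" by (rule form_elementE)
      have "[:- inverse c:] \<in> forms N 0" by (simp add: forms)
      then obtain z' where z': "z' \<in> carrier S" "\<sigma> z' = monom [:- inverse c:] 0" by (rule form_elementE)
      have "\<sigma> (z \<otimes>\<^bsub>S\<^esub> h \<oplus>\<^bsub>S\<^esub> z' \<otimes>\<^bsub>S\<^esub> h1) = monom 1 d"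
        using z(1) z'(1) hc h1(2) c
        by (simp add: \<sigma>_add \<sigma>_mult z(2) z'(2) h(2) h1(3) mult_monom add_monom cq one_pCons)
      moreover have "z \<otimes>\<^bsub>S\<^esub> h \<oplus>\<^bsub>S\<^esub> z' \<otimes>\<^bsub>S\<^esub> h1 \<in> P"
        using hP h1P z(1) z'(1) by (simp add: P.I_l_closed)
      ultimately show False using monomial_notin_point P.Icarr by blast
    qed
  qed
qed

lemma point_eq_cusp: "P = cusp"
proof -
  have PC: "P \<subseteq> carrier S" using proj_point_prime[OF P] by blast
  have iff: "x \<in> P \<longleftrightarrow> (\<forall>d. coeff (coeff (\<sigma> x) d) 0 = 0)" if x: "x \<in> carrier S" for x
  proof -
    have "x \<in> P \<longleftrightarrow> (\<forall>d. component d x \<in> P)"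
      using P x ideal_component_induct[OF proj_point_prime(2)[OF P] x] by (auto simp: proj_points_iff)
    then show ?thesis
      using homogeneous_in_point_iff[OF component_grade[OF x] component(2)[OF x]] by simp
  qed
  then show ?thesis using PC unfolding cusp_def by blast
qed

end

text \<open>
  The ideal consists of the elements whose image in \<open>k[u][T]\<close> is divisible by \<open>u\<close>, which is a prime
  element there.
\<close>

lemma cusp_proj_point: "cusp \<in> proj_points S"
proof -
  have udvd: "[:0, 1:] dvd p \<longleftrightarrow> coeff p 0 = 0" for p :: "'k poly"
    using poly_eq_0_iff_dvd[of p 0] by (simp add: poly_0_coeff_0)
  have dvd: "x \<in> cusp \<longleftrightarrow> x \<in> carrier S \<and> [:[:0, 1:]:] dvd \<sigma> x" for x
    by (simp add: cusp_def const_poly_dvd_iff udvd)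
  have "prime_elem [:0, 1::'k:]"
  proof (rule prime_elemI)
    show "[:0, 1::'k:] dvd p \<or> [:0, 1:] dvd q" if "[:0, 1:] dvd p * q" for p q :: "'k poly"
      using that by (simp add: udvd coeff_mult)
    show "\<not> is_unit [:0, 1::'k:]" by (simp add: is_unit_iff_degree)
  qed simp
  then have pe: "prime_elem [:[:0, 1::'k:]:]" by (simp add: prime_elem_const_poly_iff)
  interpret cring S by (rule cring)
  have neg: "\<sigma> (\<ominus>\<^bsub>S\<^esub> x) = - \<sigma> x" if x: "x \<in> carrier S" for x
  proof -
    have "\<sigma> (\<ominus>\<^bsub>S\<^esub> x) + \<sigma> x = 0"
      using \<sigma>_add[of "\<ominus>\<^bsub>S\<^esub> x" x] x by (simp add: l_neg \<sigma>_zero)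
    then show ?thesis by (simp add: eq_neg_iff_add_eq_0)
  qed
  have "subgroup cusp (add_monoid S)"
  proof (rule add.subgroupI)
    have "\<zero>\<^bsub>S\<^esub> \<in> cusp" by (simp add: dvd \<sigma>_zero)
    then show "cusp \<noteq> {}" by blast
  qed (auto simp: dvd neg \<sigma>_add)
  then have "ideal cusp S"
    by (rule idealI[OF ring_axioms]) (auto simp: dvd \<sigma>_mult)
  moreover have "carrier S \<noteq> cusp"
  proof -
    have "\<one>\<^bsub>S\<^esub> \<notin> cusp" by (auto simp: cusp_def \<sigma>_one intro!: exI[of _ 0])
    then show ?thesis by blast
  qed
  ultimately have "primeideal cusp S"
    by (rule primeidealI[OF _ cring]) (auto simp: dvd \<sigma>_mult prime_elem_dvd_mult_iff[OF pe])
  moreover have "component d x \<in> cusp" if "x \<in> cusp" for d x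
    using that by (auto simp: cusp_def component)
  moreover have "\<exists>d>0. \<exists>h\<in>grade S d. h \<notin> cusp"
  proof -
    have "1 \<in> forms N 1" by (simp add: forms)
    then obtain t where t: "t \<in> grade S 1" "t \<in> carrier S" "\<sigma> t = monom 1 1"
      by (rule form_elementE)
    then have "t \<notin> cusp" by (auto simp: cusp_def)
    then show ?thesis using t(1) by (intro exI[of _ 1]) auto
  qed
  ultimately show ?thesis by (simp add: proj_points_iff)
qed

end

section \<open>Projection of the twisted cubic to the cuspidal cubic\<close>

text \<open>
  \<open>S\<close> is the coordinate ring of the cuspidal cubic and \<open>T\<close> that of the twisted cubic. The inclusion of
  \<open>S\<close> in \<open>T\<close> is obtained by comparing both with \<open>k[u][T]\<close>.
\<close>

locale cuspidal_projection =
  S: cuspidal_model S \<sigma> 2 + T: cuspidal_model T \<tau> 3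
  for S :: "('a, 'k::field) graded_algebra" (structure) and \<sigma>
    and T :: "('b, 'k) graded_algebra" and \<tau> +
  assumes S_scalar: "scalar S c \<in> grade S 0" "\<sigma> (scalar S c) = [:[:c:]:]"
    and T_scalar: "scalar T c \<in> grade T 0" "\<tau> (scalar T c) = [:[:c:]:]"
begin

definition inclusion :: "'a \<Rightarrow> 'b" where
  "inclusion x = inv_into (carrier T) \<tau> (\<sigma> x)"

lemma forms_mono: "forms 2 d \<subseteq> (forms 3 d :: 'k poly set)"
  by (auto simp: S.forms T.forms)

sublocale graded_extension S S.component T T.component inclusion
  unfolding inclusion_def
  by (rule graded_extension_of_embeddings(1)[OF S.graded_embedding_axioms T.graded_embedding_axioms forms_mono])
    (simp_all add: S_scalar T_scalar T.grade_carrier[OF T_scalar(1)])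

lemma \<tau>_inclusion [simp]: "x \<in> carrier S \<Longrightarrow> \<tau> (inclusion x) = \<sigma> x"
  using graded_extension_of_embeddings(2)[OF S.graded_embedding_axioms T.graded_embedding_axioms forms_mono,
      OF S_scalar(1) T.grade_carrier[OF T_scalar(1)], of x]
  by (simp add: inclusion_def S_scalar(2) T_scalar(2))

text \<open>
  Membership in the smaller ring is a condition on coefficients; this is how the absence of a linear
  term is used.
\<close>

lemma in_image:
  assumes "b \<in> carrier T" "\<And>d. coeff (\<tau> b) d \<in> forms 2 d"
  shows "b \<in> inclusion ` carrier S"
proof -
  obtain a where a: "a \<in> carrier S" "\<sigma> a = \<tau> b" using S.\<sigma>_surj[OF assms(2)] by metis
  then have "inclusion a = b" using assms(1) by (intro T.\<sigma>_eqI) simp_all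
  then show ?thesis using a(1) by blast
qed

lemma cube_form: "monom 1 3 \<in> forms 2 1"
  by (simp add: S.forms degree_monom_eq)

text \<open>The element \<open>u\<^sup>3T\<close>; in the coordinate ring it is the class of \<open>x\<^sub>2\<close>.\<close>

definition cube :: 'a where
  "cube = (SOME y. y \<in> grade S 1 \<and> \<sigma> y = monom (monom 1 3) 1)"

lemma cube: "cube \<in> grade S 1" "\<sigma> cube = monom (monom 1 3) 1"
proof -
  have "\<exists>y. y \<in> grade S 1 \<and> \<sigma> y = monom (monom 1 3) 1"
    using S.homogeneousE[OF cube_form] by metis
  then have "cube \<in> grade S 1 \<and> \<sigma> cube = monom (monom 1 3) 1"
    unfolding cube_def by (rule someI_ex)
  then show "cube \<in> grade S 1" "\<sigma> cube = monom (monom 1 3) 1" by auto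
qed

lemma cube_carrier: "cube \<in> carrier S"
  using cube(1) S.grade_carrier by blast

text \<open>The product of \<open>u\<^sup>3\<close> with any polynomial in \<open>u\<close> has no linear term.\<close>

lemma conductor:
  assumes b: "b \<in> carrier T"
  shows "inclusion cube \<otimes>\<^bsub>T\<^esub> b \<in> inclusion ` carrier S"
proof (rule in_image)
  show "inclusion cube \<otimes>\<^bsub>T\<^esub> b \<in> carrier T" using b cube_carrier by simp
  show "coeff (\<tau> (inclusion cube \<otimes>\<^bsub>T\<^esub> b)) d \<in> forms 2 d" for d
  proof (cases "d = 0")
    case True
    then show ?thesis
      using b by (simp add: T.\<sigma>_mult cube cube_carrier coeff_monom_mult S.forms)
  next
    case False
    have "degree (coeff (\<tau> b) (d - 1)) \<le> 3 * (d - 1)"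
      using T.\<sigma>_coeff[OF b, of "d - 1"] by (simp add: T.forms)
    then have "degree (monom 1 3 * coeff (\<tau> b) (d - 1)) \<le> 3 * d"
      using degree_mult_le[of "monom 1 3" "coeff (\<tau> b) (d - 1)"] False by (simp add: degree_monom_eq)
    then show ?thesis
      using b False by (simp add: T.\<sigma>_mult cube cube_carrier coeff_monom_mult S.forms)
  qed
qed

lemma contraction_cusp: "contraction T.cusp = S.cusp"
  by (auto simp: contraction_def T.cusp_def S.cusp_def)

sublocale proj_homeomorphism S S.component T T.component inclusion
proof
  fix P h d assume P: "P \<in> proj_points T" and h: "h \<in> grade T d" "h \<notin> P"
  show "\<exists>e. \<exists>w\<in>grade T e. w \<notin> P \<and> h \<otimes>\<^bsub>T\<^esub> w \<in> inclusion ` carrier S"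
  proof (cases "inclusion cube \<in> P")
    case False
    have "h \<otimes>\<^bsub>T\<^esub> inclusion cube \<in> inclusion ` carrier S"
      using conductor[of h] T.grade_carrier[OF h(1)] cube_carrier by (simp add: T.m_comm)
    then show ?thesis using hom_grade[OF cube(1)] False by blast
  next
    case True
    obtain p where p: "p \<in> forms 3 d" "\<tau> h = monom p d" and hc: "h \<in> carrier T"
      using T.homogeneousD[OF h(1)] .
    have in_P: "x \<in> P \<longleftrightarrow> coeff q 0 = 0" if "x \<in> grade T e" "\<tau> x = monom q e" for x q e
      using T.homogeneous_in_point_iff[OF P True _ that] cube cube_carrier by simp
    have p0: "coeff p 0 \<noteq> 0" using in_P[OF h(1) p(2)] h(2) by simp
    \<comment> \<open>The linear term of \<open>p (1 + \<alpha>u)\<close> is \<open>p\<^sub>1 + \<alpha>p\<^sub>0\<close>, which this choice makes zero.\<close>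
    define \<alpha> where "\<alpha> = - coeff p 1 / coeff p 0"
    have "[:1, \<alpha>:] \<in> forms 3 1" by (simp add: T.forms)
    then obtain w where w: "w \<in> grade T 1" "\<tau> w = monom [:1, \<alpha>:] 1" by (rule T.homogeneousE)
    have wc: "w \<in> carrier T" using w(1) T.grade_carrier by blast
    have "w \<notin> P" using in_P[OF w] by simp
    moreover have "h \<otimes>\<^bsub>T\<^esub> w \<in> inclusion ` carrier S"
    proof (rule in_image)
      show "h \<otimes>\<^bsub>T\<^esub> w \<in> carrier T" using hc wc by simp
      have "coeff (p * [:1, \<alpha>:]) 1 = coeff p 1 + \<alpha> * coeff p 0"
        by (simp add: coeff_pCons mult.commute)
      then have "coeff (p * [:1, \<alpha>:]) 1 = 0" using p0 by (simp add: \<alpha>_def)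
      moreover have "degree (p * [:1, \<alpha>:]) \<le> 3 * (d + 1)"
        using degree_mult_le[of p "[:1, \<alpha>:]"] degree_pCons_le[of 1 "[:\<alpha>:]"] p(1) by (simp add: T.forms)
      ultimately have "p * [:1, \<alpha>:] \<in> forms 2 (d + 1)" by (simp only: S.forms) simp
      then show "coeff (\<tau> (h \<otimes>\<^bsub>T\<^esub> w)) e \<in> forms 2 e" for e
        using hc wc by (auto simp: T.\<sigma>_mult p(2) w(2) mult_monom S.zero_coeff simp del: mult_pCons_right)
    qed
    ultimately show ?thesis using w(1) by blast
  qed
next
  fix Q assume Q: "Q \<in> proj_points S"
  show "\<exists>P\<in>proj_points T. contraction P = Q"
  proof (cases "cube \<in> Q")
    case False
    show ?thesis by (rule conductor_lying_over[OF cube(1) _ conductor Q False]) simp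
  next
    case True
    have "Q = S.cusp" by (rule S.point_eq_cusp[OF Q True cube(2)])
    then show ?thesis using contraction_cusp T.cusp_proj_point by blast
  qed
qed

lemma same_krull_dim: "krull_dim (space_top (Proj S)) = krull_dim (space_top (Proj T))"
  using homeomorphic_map_krull_dim[OF homeomorphic_contraction] by (simp add: Proj_def)

lemma birational_Proj: "birational (Proj T) (Proj S)"
proof -

  have "basic_open S cube \<noteq> {}"
  proof -
    \<comment> \<open>The generic point lies in every nonempty open set.\<close>
    have "{\<zero>} \<in> proj_points S"
    proof -
      have "cube \<noteq> \<zero>" using cube(2) S.\<sigma>_zero by auto
      then show ?thesis
        using S.zeroprimeideal cube(1) by (auto simp: S.proj_points_iff intro!: exI[of _ 1])
    qed
    moreover have "cube \<notin> {\<zero>}" using cube(2) S.\<sigma>_zero by auto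
    ultimately show ?thesis by (auto simp: basic_open_def)
  qed
  moreover have "contraction ` basic_open T (inclusion cube) \<supseteq> basic_open S cube"
    using lying_over cube_carrier by (force simp: basic_open_def contraction_def)
  ultimately have "basic_open T (inclusion cube) \<noteq> {}" by blast
  then show ?thesis
    unfolding birational_def
    using isomorphic_over_basic_open[OF cube(1) conductor] \<open>basic_open S cube \<noteq> {}\<close>
      S.openin_basic[OF cube(1)] T.openin_basic[OF hom_grade[OF cube(1)]]
    by (intro exI[of _ "basic_open T (inclusion cube)"] exI[of _ "basic_open S cube"])
      (simp add: Proj_def)
qed

end

section \<open>Hilbert polynomials\<close>

lemma subfield_scalars:
  fixes S :: "('a, 'k::field) graded_algebra" (structure)
  assumes "graded_embedding S \<sigma> V"
    and scalar: "\<And>c. scalar S c \<in> carrier S" "\<And>c. \<sigma> (scalar S c) = [:[:c:]:]"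
  shows "subfield (range (scalar S)) S"
proof -
  interpret graded_embedding S \<sigma> V by fact
  have mult: "scalar S a \<otimes> scalar S b = scalar S (a * b)" for a b
    by (rule \<sigma>_eqI) (simp_all add: \<sigma>_mult scalar)
  have add: "scalar S a \<oplus> scalar S b = scalar S (a + b)" for a b
    by (rule \<sigma>_eqI) (simp_all add: \<sigma>_add scalar)
  have one: "\<one> = scalar S 1"
    by (rule \<sigma>_eqI) (simp_all add: \<sigma>_one scalar one_pCons)
  have zero: "\<zero> = scalar S 0"
    by (rule \<sigma>_eqI) (simp_all add: \<sigma>_zero scalar)
  have neg: "\<ominus> scalar S a = scalar S (- a)" for a
    by (rule minus_equality) (simp_all add: add scalar zero)
  have inj: "scalar S a = scalar S b \<longleftrightarrow> a = b" for a b
    by (metis scalar(2) pCons_eq_iff)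
  have "subcring (range (scalar S)) S"
  proof (rule subcringI'[OF subringI])
    show "range (scalar S) \<subseteq> carrier S" using scalar by auto
    show "\<one> \<in> range (scalar S)" unfolding one by blast
  qed (auto simp: neg mult add)
  then show ?thesis
  proof (rule subfieldI)
    show "Units (S\<lparr>carrier := range (scalar S)\<rparr>) = range (scalar S) - {\<zero>}"
    proof (intro equalityI subsetI)
      fix x assume "x \<in> Units (S\<lparr>carrier := range (scalar S)\<rparr>)"
      then obtain a b where "x = scalar S a" "scalar S (a * b) = scalar S 1"
        by (auto simp: Units_def mult one)
      then show "x \<in> range (scalar S) - {\<zero>}" by (auto simp: inj zero)
    next
      fix x assume "x \<in> range (scalar S) - {\<zero>}"
      then obtain a where "x = scalar S a" "a \<noteq> 0" by (auto simp: zero)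
      then show "x \<in> Units (S\<lparr>carrier := range (scalar S)\<rparr>)"
        by (auto simp: Units_def mult one inj intro!: exI[of _ "inverse a"])
    qed
  qed
qed

text \<open>
  The monomials \<open>u\<^sup>j T\<^sup>d\<close> are a basis of the forms of degree \<open>d\<close>; adding one exponent \<open>j\<close> at a time
  extends the span by one dimension.
\<close>

lemma hilbert_function_forms:
  fixes S :: "('a, 'k::field) graded_algebra" (structure)
  assumes "graded_embedding S \<sigma> (forms N)"
    and scalar: "\<And>c. scalar S c \<in> carrier S" "\<And>c. \<sigma> (scalar S c) = [:[:c:]:]"
    and fin: "finite (weights N d)"
  shows "hilbert_function S d = card (weights N d)"
proof -
  interpret graded_embedding S \<sigma> "forms N" by fact
  let ?K = "range (scalar S)"
  define E where "E X = {x \<in> carrier S. \<exists>p. \<sigma> x = monom p d \<and> (\<forall>j. coeff p j \<noteq> 0 \<longrightarrow> j \<in> X)}" for X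
  have "dimension (card X) ?K (E X)" if "finite X" "X \<subseteq> weights N d" for X
    using that
  proof (induction X rule: finite_induct)
    case empty
    have "x = \<zero>" if "x \<in> E {}" for x
    proof (rule \<sigma>_eqI)
      obtain p where "\<sigma> x = monom p d" "\<And>j. coeff p j = 0" using \<open>x \<in> E {}\<close> by (auto simp: E_def)
      then show "\<sigma> x = \<sigma> \<zero>" by (simp add: \<sigma>_zero poly_eq_iff)
    qed (use that in \<open>auto simp: E_def\<close>)
    moreover have "\<zero> \<in> E {}" by (auto simp: E_def \<sigma>_zero intro!: exI[of _ 0])
    ultimately have "E {} = {\<zero>}" by blast
    then show ?case using zero_dim[of ?K] by simp
  next
    case (insert j X)
    have "monom 1 j \<in> forms N d" using insert.prems by (simp add: forms_def)
    then obtain v where v: "v \<in> grade S d" "\<sigma> v = monom (monom 1 j) d" by (rule homogeneousE)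
    have vc: "v \<in> carrier S" using v(1) grade_carrier by blast
    have "v \<notin> E X" using insert.hyps(2) by (auto simp: E_def v(2))
    moreover have "E (insert j X) = line_extension ?K v (E X)"
    proof (intro equalityI subsetI)
      fix x assume "x \<in> E (insert j X)"
      then obtain p where x: "x \<in> carrier S" "\<sigma> x = monom p d" and p: "\<And>i. coeff p i \<noteq> 0 \<Longrightarrow> i \<in> insert j X"
        by (auto simp: E_def)
      define q where "q = p - monom (coeff p j) j"
      have q: "coeff q i \<noteq> 0 \<longrightarrow> i \<in> X" for i
        using p[of i] by (cases "i = j") (auto simp: q_def)
      then have "q \<in> forms N d" using insert.prems by (auto simp: forms_def)
      then obtain w where w: "w \<in> grade S d" "\<sigma> w = monom q d" by (rule homogeneousE)
      have wc: "w \<in> carrier S" using w(1) grade_carrier by blast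
      have "w \<in> E X" using wc w(2) q by (auto simp: E_def)
      moreover have "x = scalar S (coeff p j) \<otimes> v \<oplus> w"
        using x(1) vc wc scalar(1)
        by (intro \<sigma>_eqI) (simp_all add: \<sigma>_add \<sigma>_mult scalar(2) x(2) v(2) w(2) q_def smult_monom add_monom)
      ultimately show "x \<in> line_extension ?K v (E X)" by (auto simp: line_extension_mem_iff)
    next
      fix x assume "x \<in> line_extension ?K v (E X)"
      then obtain c w where x: "x = scalar S c \<otimes> v \<oplus> w" and w: "w \<in> E X"
        by (auto simp: line_extension_mem_iff)
      obtain q where q: "w \<in> carrier S" "\<sigma> w = monom q d" "\<And>i. coeff q i \<noteq> 0 \<Longrightarrow> i \<in> X"
        using w by (auto simp: E_def)
      have "\<sigma> x = monom (monom c j + q) d"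
        using q(1) vc scalar(1) by (simp add: x \<sigma>_add \<sigma>_mult scalar(2) v(2) q(2) smult_monom add_monom)
      moreover have "x \<in> carrier S" using q(1) vc scalar(1) by (simp add: x)
      moreover have "i \<in> insert j X" if "coeff (monom c j + q) i \<noteq> 0" for i
        using that q(3)[of i] by (auto split: if_splits)
      ultimately show "x \<in> E (insert j X)" unfolding E_def by blast
    qed
    ultimately show ?case
      using Suc_dim[OF vc, of "E X" "card X" ?K] insert by simp
  qed
  from this[OF fin] have "dimension (card (weights N d)) ?K (E (weights N d))" by simp
  moreover have "E (weights N d) = grade S d"
    using \<sigma>_coeff[of _ d] by (force simp: E_def \<sigma>_grade forms_def)
  ultimately show ?thesis
    unfolding hilbert_function_def
    using dimI[OF subfield_scalars[OF graded_embedding_axioms scalar]] by (simp add: over_def)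
qed

text \<open>
  Polynomials that agree at infinitely many points are equal, so at most one polynomial satisfies the
  definite description.
\<close>

lemma hilbert_polynomial_eqI:
  assumes "\<forall>\<^sub>F t in sequentially. poly P (of_nat t) = of_nat (hilbert_function S t)"
  shows "hilbert_polynomial S = P"
  unfolding hilbert_polynomial_def
proof (rule the_equality)
  fix Q :: "rat poly"
  assume "\<forall>\<^sub>F t in sequentially. poly Q (of_nat t) = of_nat (hilbert_function S t)"
  with assms have "\<forall>\<^sub>F t in sequentially. poly (Q - P) (of_nat t) = 0"
    by eventually_elim simp
  then obtain n where n: "\<And>t. t \<ge> n \<Longrightarrow> poly (Q - P) (of_nat t) = 0"
    by (auto simp: eventually_sequentially)
  have "infinite ((of_nat :: nat \<Rightarrow> rat) ` {n..})"
    by (simp add: finite_image_iff infinite_Ici)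
  moreover have "(of_nat :: nat \<Rightarrow> rat) ` {n..} \<subseteq> {x. poly (Q - P) x = 0}" using n by auto
  ultimately have "Q - P = 0" using poly_roots_finite finite_subset by blast
  then show "Q = P" by simp
qed (rule assms)

lemma curve_algebra_hilbert_function:
  assumes "N = 2 \<or> N = 3"
  shows "hilbert_function (curve_algebra N :: ('k::field mpoly set, 'k) graded_algebra) t =
    card (weights N t)"
proof -
  interpret graded_embedding "curve_algebra N :: ('k mpoly set, 'k) graded_algebra" class_param "forms N"
    by (rule curve_algebra_embedding)
  show ?thesis
  proof (rule hilbert_function_forms[OF graded_embedding_axioms])
    show "finite (weights N t)" using assms by (auto simp: weights_2 weights_3)
  qed (auto simp: curve_algebra_scalar intro: grade_carrier[OF curve_algebra_scalar(1)])
qed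

lemma hilbert_polynomial_twisted_cubic:
  "hilbert_polynomial (curve_algebra 3 :: ('k::field mpoly set, 'k) graded_algebra) = [:1, 3:]"
  by (rule hilbert_polynomial_eqI) (simp add: curve_algebra_hilbert_function weights_3)

lemma hilbert_polynomial_cuspidal_cubic:
  "hilbert_polynomial (curve_algebra 2 :: ('k::field mpoly set, 'k) graded_algebra) = [:0, 3:]"
proof (rule hilbert_polynomial_eqI)
  \<comment> \<open>In degree \<open>0\<close> the exponent \<open>1\<close> is not there to be removed, hence the restriction on \<open>t\<close>.\<close>
  have "card (weights 2 t) = 3 * t" if "t \<ge> 1" for t
    using that by (simp add: weights_2 card_Diff_singleton)
  then show "\<forall>\<^sub>F t in sequentially. poly [:0, 3:] (of_nat t) =
      (of_nat (hilbert_function (curve_algebra 2 :: ('k mpoly set, 'k) graded_algebra) t) :: rat)"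
    by (intro eventually_sequentiallyI[of 1]) (simp add: curve_algebra_hilbert_function)
qed

theorem corollary2p8:
  shows "\<exists>(N::nat) (I :: 'k::field mpoly set) (N'::nat) (I' :: 'k mpoly set).
    projective_variety N I \<and> projective_variety N' I'
    \<and> variety_dim N I = variety_dim N' I'
    \<and> birational (variety_space N I) (variety_space N' I')
    \<and> arithmetic_genus N I \<noteq> arithmetic_genus N' I'"
proof (intro exI conjI)
  let ?S = "curve_algebra 2 :: ('k mpoly set, 'k) graded_algebra"
  let ?T = "curve_algebra 3 :: ('k mpoly set, 'k) graded_algebra"
  interpret cuspidal_projection ?S class_param ?T class_param
  proof (intro cuspidal_projection.intro cuspidal_model.intro curve_algebra_embedding)
    show "cuspidal_projection_axioms ?S class_param ?T class_param"
      by unfold_locales (rule curve_algebra_scalar)+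
  qed (unfold_locales; simp)+
  show "projective_variety 3 (curve_ideal 3 :: 'k mpoly set)"
    and "projective_variety 2 (curve_ideal 2 :: 'k mpoly set)"
    by (rule curve_ideal_variety)+
  show "variety_dim 3 (curve_ideal 3 :: 'k mpoly set) = variety_dim 2 (curve_ideal 2 :: 'k mpoly set)"
    unfolding variety_dim_def variety_space_def by (rule same_krull_dim[symmetric])
  show "birational (variety_space 3 (curve_ideal 3 :: 'k mpoly set))
      (variety_space 2 (curve_ideal 2 :: 'k mpoly set))"
    unfolding variety_space_def by (rule birational_Proj)
  show "arithmetic_genus 3 (curve_ideal 3 :: 'k mpoly set) \<noteq> arithmetic_genus 2 (curve_ideal 2 :: 'k mpoly set)"
    by (simp add: arithmetic_genus_def hilbert_polynomial_twisted_cubic hilbert_polynomial_cuspidal_cubic)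
qed

end
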